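(* Let $n\ge 3$ and let $F_n^2$ be the complex Leibniz algebra with basis $\{e_1,\dots,e_n\}$ and $[e_1,e_1]=e_3$, $[e_i,e_1]=e_{i+1}$ for $3\le i\le n-1$. An arbitrary one-dimensional central extension of $F_n^2$ is isomorphic to one of the following pairwise non-isomorphic algebras: - $F_n^2\oplus\mathbb{C}$; - $F_{n+1}^2$; - $F_{n+1}^2(0,\dots,0,0,1)$; - $F_{n+1}^2(0,\dots,0,1,0)$; - $L_{n+1}^{1,\lambda}$ with $\lambda\in\mathbb{C}$; - $L_{n+1}^{2,\lambda}$ with $\lambda\in\{0,1\}$; - $L_{n+1}^2$.
   Context: All vector spaces and algebras are finite-dimensional over $\mathbb{C}$; in multiplication tables omitted products of basis elements are zero. A Leibniz algebra is an algebra $L$ with bilinear product satisfying $[x,[y,z]]=[[x,y],z]-[[x,z],y]$. $\mathbb{C}$ as a direct summand denotes the one-dimensional abelian algebra. A $k$-dimensional central extension of a Leibniz algebra $L$ is a Leibniz algebra $\widehat L$ fitting into a short exact sequence of Leibniz algebras $0\to V\to\widehat L\to L\to0$ with $\dim V=k$ and the image of $V$ contained in the center of $\widehat L$; equivalently $\widehat L\cong L\oplus V$ with product $[x+u,y+v]=[x,y]_L+\theta(x,y)$, where $\theta:L\times L\to V$ is bilinear with $\theta(x,[y,z])=\theta([x,y],z)-\theta([x,z],y)$. The algebra $F_{n+1}^2(0,\dots,0,\beta,\gamma)$ has basis $\{e_1,\dots,e_{n+1}\}$ and products $[e_1,e_1]=e_3$, $[e_i,e_1]=e_{i+1}$ ($3\le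 i\le n$), $[e_1,e_2]=\beta e_{n+1}$, $[e_2,e_2]=\gamma e_{n+1}$; $F_{n+1}^2$ is the case $\beta=\gamma=0$. Thus $F_{n+1}^2(0,\dots,0,0,1)$ has $(\beta,\gamma)=(0,1)$ and $F_{n+1}^2(0,\dots,0,1,0)$ has $(\beta,\gamma)=(1,0)$. The following algebras have dimension $m$ and basis $\{e_1,\dots,e_m\}$ (used with $m=n+1$): $L_m^2$: $[e_i,e_1]=e_{i+1}$ ($1\le i\le m-3$), $[e_1,e_{m-1}]=e_m$. $L_m^{1,\lambda}$: $[e_i,e_1]=e_{i+1}$ ($1\le i\le m-3$), $[e_{m-1},e_1]=e_m$, $[e_1,e_{m-1}]=\lambda e_m$. $L_m^{2,\lambda}$: $[e_i,e_1]=e_{i+1}$ ($1\le i\le m-3$), $[e_{m-1},e_1]=e_m$, $[e_1,e_{m-1}]=\lambda e_m$, $[e_{m-1},e_{m-1}]=e_m$. *)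

theory Defs
  imports Complex_Main "HOL-Library.Function_Algebras" "HOL-Library.Product_Plus"
begin

(* The carrier is a subspace of an ambient complex vector space (the whole type with smul).
   This lets the dimension of the coordinate algebras below depend on a natural number. *)
record 'a calgebra =
  carrier :: "'a set"
  smul :: "complex \<Rightarrow> 'a \<Rightarrow> 'a"
  bracket :: "'a \<Rightarrow> 'a \<Rightarrow> 'a"

locale leibniz_algebra = vector_space "smul L"
  for L :: "'a::ab_group_add calgebra" +
  assumes subspace_carrier: "subspace (carrier L)"
    and finite_dimensional: "\<exists>B. finite B \<and> span B = carrier L"
    and bracket_closed:
      "\<lbrakk>x \<in> carrier L; y \<in> carrier L\<rbrakk> \<Longrightarrow> bracket L x y \<in> carrier L"
    and bracket_add_left:
      "\<lbrakk>x \<in> carrier L; y \<in> carrier L; z \<in> carrier L\<rbrakk>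
        \<Longrightarrow> bracket L (x + y) z = bracket L x z + bracket L y z"
    and bracket_add_right:
      "\<lbrakk>x \<in> carrier L; y \<in> carrier L; z \<in> carrier L\<rbrakk>
        \<Longrightarrow> bracket L x (y + z) = bracket L x y + bracket L x z"
    and bracket_smul_left:
      "\<lbrakk>x \<in> carrier L; y \<in> carrier L\<rbrakk>
        \<Longrightarrow> bracket L (smul L a x) y = smul L a (bracket L x y)"
    and bracket_smul_right:
      "\<lbrakk>x \<in> carrier L; y \<in> carrier L\<rbrakk>
        \<Longrightarrow> bracket L x (smul L a y) = smul L a (bracket L x y)"
    and leibniz:
      "\<lbrakk>x \<in> carrier L; y \<in> carrier L; z \<in> carrier L\<rbrakk>
        \<Longrightarrow> bracket L x (bracket L y z)
            = bracket L (bracket L x y) z - bracket L (bracket L x z) y"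

definition center :: "'a::zero calgebra \<Rightarrow> 'a set" where
  "center L = {x \<in> carrier L. \<forall>y\<in>carrier L. bracket L x y = 0 \<and> bracket L y x = 0}"

definition alg_hom ::
  "'a::plus calgebra \<Rightarrow> 'b::plus calgebra \<Rightarrow> ('a \<Rightarrow> 'b) \<Rightarrow> bool" where
  "alg_hom A B f \<longleftrightarrow>
     (\<forall>x\<in>carrier A. f x \<in> carrier B) \<and>
     (\<forall>x\<in>carrier A. \<forall>y\<in>carrier A. f (x + y) = f x + f y) \<and>
     (\<forall>a. \<forall>x\<in>carrier A. f (smul A a x) = smul B a (f x)) \<and>
     (\<forall>x\<in>carrier A. \<forall>y\<in>carrier A. f (bracket A x y) = bracket B (f x) (f y))"

definition alg_iso :: "'a::plus calgebra \<Rightarrow> 'b::plus calgebra \<Rightarrow> bool" (infix "\<cong>" 50) where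
  "A \<cong> B \<longleftrightarrow> (\<exists>f. alg_hom A B f \<and> bij_betw f (carrier A) (carrier B))"

locale central_extension =
  V: leibniz_algebra V + E: leibniz_algebra E + L: leibniz_algebra L
  for k :: nat
    and V :: "'v::ab_group_add calgebra"
    and E :: "'e::ab_group_add calgebra"
    and L :: "'l::ab_group_add calgebra"
    and \<iota> :: "'v \<Rightarrow> 'e"
    and \<pi> :: "'e \<Rightarrow> 'l" +
  assumes hom_\<iota>: "alg_hom V E \<iota>"
    and hom_\<pi>: "alg_hom E L \<pi>"
    and inj_\<iota>: "inj_on \<iota> (carrier V)"
    and exact: "\<iota> ` carrier V = {x \<in> carrier E. \<pi> x = 0}"
    and surj_\<pi>: "\<pi> ` carrier E = carrier L"
    and dim_V: "V.dim (carrier V) = k"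
    and central: "\<iota> ` carrier V \<subseteq> center E"

definition direct_sum :: "'a calgebra \<Rightarrow> 'b calgebra \<Rightarrow> ('a \<times> 'b) calgebra" where
  "direct_sum A B =
     \<lparr>carrier = carrier A \<times> carrier B,
      smul = (\<lambda>a (x, y). (smul A a x, smul B a y)),
      bracket = (\<lambda>(x, y) (x', y'). (bracket A x x', bracket B y y'))\<rparr>"

definition abelian1 :: "complex calgebra" where
  "abelian1 = \<lparr>carrier = UNIV, smul = (*), bracket = (\<lambda>_ _. 0)\<rparr>"

definition basis_vec :: "nat \<Rightarrow> nat \<Rightarrow> complex" where
  "basis_vec i = (\<lambda>j. if j = i then 1 else 0)"

(* Algebra with basis basis_vec 1, ..., basis_vec m and [e_i, e_j] = c i j. *)
definition table_algebra ::
  "nat \<Rightarrow> (nat \<Rightarrow> nat \<Rightarrow> nat \<Rightarrow> complex) \<Rightarrow> (nat \<Rightarrow> complex) calgebra" where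
  "table_algebra m c =
     \<lparr>carrier = {x. \<forall>i. i \<notin> {1..m} \<longrightarrow> x i = 0},
      smul = (\<lambda>a x k. a * x k),
      bracket = (\<lambda>x y k. \<Sum>i=1..m. \<Sum>j=1..m. x i * y j * c i j k)\<rparr>"

(* F_m^2(0,...,0,\<beta>,\<gamma>), for m \<ge> 3; the plain F_m^2 is F2 m 0 0. *)
definition F2 :: "nat \<Rightarrow> complex \<Rightarrow> complex \<Rightarrow> (nat \<Rightarrow> complex) calgebra" where
  "F2 m \<beta> \<gamma> = table_algebra m (\<lambda>i j.
     if i = 1 \<and> j = 1 then basis_vec 3
     else if 3 \<le> i \<and> i \<le> m - 1 \<and> j = 1 then basis_vec (i + 1)
     else if i = 1 \<and> j = 2 then (\<lambda>k. \<beta> * basis_vec m k)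
     else if i = 2 \<and> j = 2 then (\<lambda>k. \<gamma> * basis_vec m k)
     else (\<lambda>_. 0))"

(* The algebras L_m^2, L_m^{1,t} and L_m^{2,t}, for m \<ge> 4. *)
definition L2 :: "nat \<Rightarrow> (nat \<Rightarrow> complex) calgebra" where
  "L2 m = table_algebra m (\<lambda>i j.
     if 1 \<le> i \<and> i \<le> m - 3 \<and> j = 1 then basis_vec (i + 1)
     else if i = 1 \<and> j = m - 1 then basis_vec m
     else (\<lambda>_. 0))"

definition L1_par :: "nat \<Rightarrow> complex \<Rightarrow> (nat \<Rightarrow> complex) calgebra" where
  "L1_par m t = table_algebra m (\<lambda>i j.
     if 1 \<le> i \<and> i \<le> m - 3 \<and> j = 1 then basis_vec (i + 1)
     else if i = m - 1 \<and> j = 1 then basis_vec m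
     else if i = 1 \<and> j = m - 1 then (\<lambda>k. t * basis_vec m k)
     else (\<lambda>_. 0))"

definition L2_par :: "nat \<Rightarrow> complex \<Rightarrow> (nat \<Rightarrow> complex) calgebra" where
  "L2_par m t = table_algebra m (\<lambda>i j.
     if 1 \<le> i \<and> i \<le> m - 3 \<and> j = 1 then basis_vec (i + 1)
     else if i = m - 1 \<and> j = 1 then basis_vec m
     else if i = 1 \<and> j = m - 1 then (\<lambda>k. t * basis_vec m k)
     else if i = m - 1 \<and> j = m - 1 then basis_vec m
     else (\<lambda>_. 0))"

(* Labels for the list entries other than the direct sum, which lives on a product type.
   "Pairwise non-isomorphic" is stated for distinct labels, so that members of a family with
   different parameters are compared too. *)
datatype ext_label = F2_lab complex complex | L1_par_lab complex | L2_par_lab complex | L2_lab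

fun labelled_algebra :: "nat \<Rightarrow> ext_label \<Rightarrow> (nat \<Rightarrow> complex) calgebra" where
  "labelled_algebra m (F2_lab \<beta> \<gamma>) = F2 m \<beta> \<gamma>"
| "labelled_algebra m (L1_par_lab t) = L1_par m t"
| "labelled_algebra m (L2_par_lab t) = L2_par m t"
| "labelled_algebra m L2_lab = L2 m"

definition ext_labels :: "ext_label set" where
  "ext_labels =
     {F2_lab 0 0, F2_lab 0 1, F2_lab 1 0} \<union> range L1_par_lab \<union> L2_par_lab ` {0, 1} \<union> {L2_lab}"

end

theory Submission
  imports Defs
begin

text \<open>
  Let \<open>e\<^sub>1, \<dots>, e\<^sub>n\<close> be the standard basis of the algebra being extended, and write
  \<open>x\<close> and \<open>y\<close> for lifts of \<open>e\<^sub>1\<close> and \<open>e\<^sub>2\<close> to the extension and \<open>v\<close> for a generator of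
  the kernel. The right powers of \<open>x\<close> lift \<open>e\<^sub>3, \<dots>, e\<^sub>n\<close>; using them as basis vectors is the
  same as subtracting a coboundary from the cocycle. The Leibniz identity annihilates almost
  everything that remains: multiplication on the right by a higher power of \<open>x\<close> is zero, and so
  is a higher power of \<open>x\<close> times \<open>y\<close>. Only four numbers survive, namely the values
  \<open>a, b, c, d\<close> of the cocycle at \<open>(e\<^sub>n, e\<^sub>1), (e\<^sub>2, e\<^sub>1), (e\<^sub>1, e\<^sub>2), (e\<^sub>2, e\<^sub>2)\<close>.
  This is \<open>central_extension_is_ext_algebra\<close>, and \<open>ext_algebra n a b c d\<close> is the resulting
  algebra. Every algebra of the list is a member of this family as well
  (\<open>labelled_algebra_iso_ext_algebra\<close>, \<open>direct_sum_iso\<close>), so the theorem becomes the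
  classification of a four-parameter family.

  The substitutions \<open>x + t y\<close>, \<open>s (y - r e\<^sub>n)\<close>, \<open>w v\<close> replace \<open>(a, b, c, d)\<close> by
  \<open>(a / w, s (b + t d - r a) / w, s (c + t d) / w, s\<^sup>2 d / w)\<close>. If \<open>a \<noteq> 0\<close>, the shift by \<open>r\<close>
  removes \<open>b\<close>, and \<open>(c, d)\<close> can be brought to \<open>(0, 0)\<close>, \<open>(1, 0)\<close> or \<open>(0, 1)\<close>. If \<open>a = 0\<close>
  and \<open>d \<noteq> 0\<close>, the difference \<open>b - c\<close> is invariant under \<open>t\<close>, and only its vanishing matters.
  If \<open>a = d = 0\<close>, the point \<open>(b : c)\<close> of the projective line is a full invariant, or
  \<open>b = c = 0\<close> and the extension splits (\<open>ext_algebra_normal_form\<close>).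

  That the normal forms are distinct is seen from six properties which isomorphisms preserve
  and which can be read off from \<open>a, b, c, d\<close>. They are phrased through products and linear
  combinations of single elements, so no dimension has to be computed, and they treat
  \<open>n = 3\<close>, where \<open>e\<^sub>3\<close> and \<open>v\<close> play more symmetric roles, together with the larger \<open>n\<close>. They
  determine whether \<open>a\<close> and \<open>d\<close> vanish, whether \<open>(b, c, d)\<close> vanishes, for \<open>a = 0 \<noteq> d\<close> whether
  \<open>b = c\<close>, and for \<open>a = d = 0\<close> the ratio of \<open>c\<close> to \<open>b\<close> (\<open>ext_algebra_iso_imp\<close>).
\<close>

section \<open>Isomorphisms and algebras given by multiplication tables\<close>

lemma table_algebra_simps [simp]:
  "carrier (table_algebra m c) = {x. \<forall>i. i \<notin> {1..m} \<longrightarrow> x i = 0}"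
  "smul (table_algebra m c) = (\<lambda>a x k. a * x k)"
  "bracket (table_algebra m c) x y k = (\<Sum>i=1..m. \<Sum>j=1..m. x i * y j * c i j k)"
  by (simp_all add: table_algebra_def)

text \<open>
  The record \<open>calgebra\<close> carries no axioms. Closure under the operations is the part of them that
  makes the inverse of a bijective homomorphism a homomorphism.
\<close>

definition closed_operations :: "'a::monoid_add calgebra \<Rightarrow> bool" where
  "closed_operations A \<longleftrightarrow> 0 \<in> carrier A \<and>
     (\<forall>x\<in>carrier A. \<forall>y\<in>carrier A. x + y \<in> carrier A \<and> bracket A x y \<in> carrier A) \<and>
     (\<forall>a. \<forall>x\<in>carrier A. smul A a x \<in> carrier A)"

lemma alg_iso_sym:
  fixes A :: "'a::monoid_add calgebra" and B :: "'b::plus calgebra"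
  assumes "A \<cong> B" "closed_operations A"
  shows "B \<cong> A"
proof -
  obtain f where f: "alg_hom A B f" and bij: "bij_betw f (carrier A) (carrier B)"
    using assms(1) unfolding alg_iso_def by blast
  define g where "g = inv_into (carrier A) f"
  have gf: "g (f x) = x" if "x \<in> carrier A" for x
    using bij that by (simp add: g_def bij_betw_def)
  have ex: "\<exists>x. x \<in> carrier A \<and> f x = y" if "y \<in> carrier B" for y
    using bij_betw_imp_surj_on[OF bij] that by (metis imageE)
  have "alg_hom B A g"
    unfolding alg_hom_def
  proof (intro conjI ballI allI)
    fix u v :: 'b and a assume "u \<in> carrier B" "v \<in> carrier B"
    then obtain x y where x: "x \<in> carrier A" "f x = u" and y: "y \<in> carrier A" "f y = v"
      using ex by blast
    note cl = assms(2)[unfolded closed_operations_def] and h = f[unfolded alg_hom_def]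
    show "g (u + v) = g u + g v" using x y cl h gf by metis
    show "g (bracket B u v) = bracket A (g u) (g v)" using x y cl h gf by metis
  next
    fix u :: 'b and a assume "u \<in> carrier B"
    then obtain x where x: "x \<in> carrier A" "f x = u" using ex by blast
    note cl = assms(2)[unfolded closed_operations_def] and h = f[unfolded alg_hom_def]
    show "g u \<in> carrier A" using x gf by auto
    show "g (smul B a u) = smul A a (g u)" using x cl h gf by metis
  qed
  moreover have "bij_betw g (carrier B) (carrier A)"
    unfolding g_def using bij by (rule bij_betw_inv_into)
  ultimately show ?thesis unfolding alg_iso_def by blast
qed

lemma alg_iso_trans [trans]:
  assumes "A \<cong> B" "B \<cong> C"
  shows "A \<cong> C"
proof -
  obtain f g where f: "alg_hom A B f" "bij_betw f (carrier A) (carrier B)"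
    and g: "alg_hom B C g" "bij_betw g (carrier B) (carrier C)"
    using assms unfolding alg_iso_def by blast
  have "alg_hom A C (g \<circ> f)"
    using f(1) g(1) unfolding alg_hom_def by simp
  with bij_betw_trans[OF f(2) g(2)] show ?thesis unfolding alg_iso_def by blast
qed

lemma table_algebra_closed:
  assumes "\<And>i j k. k \<notin> {1..m} \<Longrightarrow> c i j k = 0"
  shows "closed_operations (table_algebra m c)"
  using assms by (simp add: closed_operations_def)

lemma sum_basis_vec:
  assumes "finite A" "i \<in> A"
  shows "(\<Sum>k\<in>A. basis_vec i k * z k) = z i"
proof -
  have "(\<Sum>k\<in>A. basis_vec i k * z k) = (\<Sum>k\<in>{i}. basis_vec i k * z k)"
    using assms by (intro sum.mono_neutral_right) (auto simp: basis_vec_def)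
  then show ?thesis by (simp add: basis_vec_def)
qed

lemma bracket_basis_vec:
  assumes "i \<in> {1..m}" "j \<in> {1..m}"
  shows "bracket (table_algebra m c) (basis_vec i) (basis_vec j) = c i j"
proof
  fix k
  have "bracket (table_algebra m c) (basis_vec i) (basis_vec j) k
      = (\<Sum>i'=1..m. basis_vec i i' * (\<Sum>j'=1..m. basis_vec j j' * c i' j' k))"
    by (simp add: sum_distrib_left mult.assoc)
  then show "bracket (table_algebra m c) (basis_vec i) (basis_vec j) k = c i j k"
    using assms by (simp add: sum_basis_vec)
qed

text \<open>
  Renumbering a basis. The coordinates of the image are read off at the renumbered positions, so
  the double sum defining the bracket is only reindexed.
\<close>

lemma table_algebra_permute:
  assumes \<sigma>: "bij_betw \<sigma> {1..m} {1..m}"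
    and c: "\<And>i j k. i \<in> {1..m} \<Longrightarrow> j \<in> {1..m} \<Longrightarrow> k \<in> {1..m} \<Longrightarrow> c' (\<sigma> i) (\<sigma> j) (\<sigma> k) = c i j k"
    and supp: "\<And>i j k. k \<notin> {1..m} \<Longrightarrow> c i j k = 0"
  shows "table_algebra m c' \<cong> table_algebra m c"
proof -
  define f where "f z = (\<lambda>k. if k \<in> {1..m} then z (\<sigma> k) else 0)" for z :: "nat \<Rightarrow> complex"
  define \<tau> where "\<tau> = inv_into {1..m} \<sigma>"
  have \<tau>: "\<tau> k \<in> {1..m}" "\<sigma> (\<tau> k) = k" if "k \<in> {1..m}" for k
    using bij_betw_apply[OF bij_betw_inv_into[OF \<sigma>] that] bij_betw_inv_into_right[OF \<sigma> that]
    unfolding \<tau>_def by auto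
  have \<tau>\<sigma>: "\<tau> (\<sigma> k) = k" "\<sigma> k \<in> {1..m}" if "k \<in> {1..m}" for k
    using bij_betw_inv_into_left[OF \<sigma> that] bij_betw_apply[OF \<sigma> that] unfolding \<tau>_def by auto
  have reindex: "(\<Sum>i=1..m. g i) = (\<Sum>i=1..m. g (\<sigma> i))" for g :: "nat \<Rightarrow> complex"
    using sum.reindex_bij_betw[OF \<sigma>, of g] by simp
  have "alg_hom (table_algebra m c') (table_algebra m c) f"
    unfolding alg_hom_def
  proof (intro conjI ballI allI)
    fix x y :: "nat \<Rightarrow> complex"
    show "f (bracket (table_algebra m c') x y) = bracket (table_algebra m c) (f x) (f y)"
    proof
      fix k
      show "f (bracket (table_algebra m c') x y) k = bracket (table_algebra m c) (f x) (f y) k"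
      proof (cases "k \<in> {1..m}")
        case True
        have "bracket (table_algebra m c') x y (\<sigma> k)
            = (\<Sum>i=1..m. \<Sum>j=1..m. x (\<sigma> i) * y (\<sigma> j) * c' (\<sigma> i) (\<sigma> j) (\<sigma> k))"
          unfolding table_algebra_simps
          by (subst reindex, rule sum.cong[OF refl], subst reindex, rule refl)
        also have "\<dots> = (\<Sum>i=1..m. \<Sum>j=1..m. x (\<sigma> i) * y (\<sigma> j) * c i j k)"
          using c True by (intro sum.cong refl) simp
        finally show ?thesis using True by (simp add: f_def)
      next
        case False
        then show ?thesis using supp[OF False] by (simp add: f_def del: atLeastAtMost_iff)
      qed
    qed
  qed (auto simp: f_def)
  moreover have "bij_betw f (carrier (table_algebra m c')) (carrier (table_algebra m c))"
    by (rule bij_betw_byWitness[where f' = "\<lambda>z k. if k \<in> {1..m} then z (\<tau> k) else 0"])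
      (use \<tau> \<tau>\<sigma> in \<open>auto simp: f_def fun_eq_iff\<close>)
  ultimately show ?thesis unfolding alg_iso_def by blast
qed

lemma alg_iso_refl: "A \<cong> A"
  unfolding alg_iso_def by (intro exI[of _ "\<lambda>x. x"]) (simp add: alg_hom_def bij_betw_def)

section \<open>The four-parameter family containing all the extensions\<close>

text \<open>
  The vector \<open>e\<^sub>n\<^sub>+\<^sub>1\<close> spans the kernel of the extension. The constants \<open>a, b, c, d\<close> are the
  values of a cocycle that no choice of lifts of \<open>e\<^sub>3, \<dots>, e\<^sub>n\<close> can alter. The vector \<open>e\<^sub>2\<close>
  stands outside the chain \<open>e\<^sub>1, e\<^sub>3, \<dots>, e\<^sub>n\<close> as in \<open>F\<^sub>n\<^sup>2\<close>.
\<close>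

definition ext_table :: "nat \<Rightarrow> complex \<Rightarrow> complex \<Rightarrow> complex \<Rightarrow> complex \<Rightarrow> nat \<Rightarrow> nat \<Rightarrow> nat \<Rightarrow> complex"
  where "ext_table n a b c d i j =
     (if i = 1 \<and> j = 1 then basis_vec 3
      else if 3 \<le> i \<and> i < n \<and> j = 1 then basis_vec (i + 1)
      else if i = n \<and> j = 1 then (\<lambda>k. a * basis_vec (n + 1) k)
      else if i = 2 \<and> j = 1 then (\<lambda>k. b * basis_vec (n + 1) k)
      else if i = 1 \<and> j = 2 then (\<lambda>k. c * basis_vec (n + 1) k)
      else if i = 2 \<and> j = 2 then (\<lambda>k. d * basis_vec (n + 1) k)
      else (\<lambda>_. 0))"

definition ext_algebra where
  "ext_algebra n a b c d = table_algebra (n + 1) (ext_table n a b c d)"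

lemma ext_table_support: "n \<ge> 3 \<Longrightarrow> k \<notin> {1..n+1} \<Longrightarrow> ext_table n a b c d i j k = 0"
  by (auto simp: ext_table_def basis_vec_def)

lemma carrier_ext_algebra [simp]:
  "carrier (ext_algebra n a b c d) = {x. \<forall>i. i \<notin> {1..n+1} \<longrightarrow> x i = 0}"
  by (simp add: ext_algebra_def)

lemma smul_ext_algebra [simp]: "smul (ext_algebra n a b c d) = (\<lambda>a x k. a * x k)"
  by (simp add: ext_algebra_def)

lemma ext_algebra_closed: "n \<ge> 3 \<Longrightarrow> closed_operations (ext_algebra n a b c d)"
  unfolding ext_algebra_def by (rule table_algebra_closed) (rule ext_table_support)

lemma sum_two_columns:
  fixes c :: "nat \<Rightarrow> nat \<Rightarrow> nat \<Rightarrow> complex"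
  assumes "m \<ge> 2" "\<And>i j k. j \<notin> {1, 2} \<Longrightarrow> c i j k = 0"
  shows "bracket (table_algebra m c) u w k =
    (\<Sum>i=1..m. u i * (w 1 * c i 1 k + w 2 * c i 2 k))"
proof -
  have "(\<Sum>j=1..m. u i * w j * c i j k) = u i * (w 1 * c i 1 k + w 2 * c i 2 k)" for i
  proof -
    have "(\<Sum>j=1..m. u i * w j * c i j k) = (\<Sum>j\<in>{1,2}. u i * w j * c i j k)"
      using assms by (intro sum.mono_neutral_right) auto
    then show ?thesis by (simp add: algebra_simps)
  qed
  then show ?thesis by (simp only: table_algebra_simps)
qed

lemma bracket_ext_algebra:
  assumes "n \<ge> 3"
  shows "bracket (ext_algebra n a b c d) u w =
    (\<lambda>k. if k = 3 then u 1 * w 1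
         else if 4 \<le> k \<and> k \<le> n then u (k - 1) * w 1
         else if k = n + 1 then a * u n * w 1 + b * u 2 * w 1 + c * u 1 * w 2 + d * u 2 * w 2
         else 0)" (is "_ = ?r")
proof
  fix k
  let ?t = "\<lambda>i. u i * (w 1 * ext_table n a b c d i 1 k + w 2 * ext_table n a b c d i 2 k)"
  have *: "bracket (ext_algebra n a b c d) u w k = (\<Sum>i=1..n+1. ?t i)"
    unfolding ext_algebra_def using assms
    by (intro sum_two_columns) (auto simp: ext_table_def)
  \<comment> \<open>The indices \<open>i\<close> for which \<open>[e\<^sub>i, e\<^sub>1]\<close> or \<open>[e\<^sub>i, e\<^sub>2]\<close> has a component along \<open>e\<^sub>k\<close>.\<close>
  let ?S = "if k = 3 then {1} else if 4 \<le> k \<and> k \<le> n then {k - 1}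
            else if k = n + 1 then {1, 2, n} else {}"
  have "(\<Sum>i=1..n+1. ?t i) = (\<Sum>i\<in>?S. ?t i)"
    using assms by (intro sum.mono_neutral_right) (auto simp: ext_table_def basis_vec_def)
  also have "\<dots> = ?r k"
    using assms by (auto simp: ext_table_def basis_vec_def algebra_simps)
  finally show "bracket (ext_algebra n a b c d) u w k = ?r k" using * by simp
qed

lemma F2_eq_ext_algebra: "n \<ge> 3 \<Longrightarrow> F2 (n + 1) \<beta> \<gamma> = ext_algebra n 1 0 \<beta> \<gamma>"
  unfolding F2_def ext_algebra_def by (intro arg_cong[where f = "table_algebra (n+1)"] ext)
    (auto simp: ext_table_def)

text \<open>
  The algebras \<open>L\<^sub>m\<^sup>2\<close>, \<open>L\<^sub>m\<^sup>1\<^sup>,\<^sup>t\<close> and \<open>L\<^sub>m\<^sup>2\<^sup>,\<^sup>t\<close> for \<open>m = n + 1\<close> as one family. The vector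
  outside the chain is \<open>e\<^sub>n\<close> here, not \<open>e\<^sub>2\<close>.
\<close>

definition L_table :: "nat \<Rightarrow> complex \<Rightarrow> complex \<Rightarrow> complex \<Rightarrow> nat \<Rightarrow> nat \<Rightarrow> nat \<Rightarrow> complex" where
  "L_table n b c d i j =
     (if 1 \<le> i \<and> i \<le> n - 2 \<and> j = 1 then basis_vec (i + 1)
      else if i = n \<and> j = 1 then (\<lambda>k. b * basis_vec (n + 1) k)
      else if i = 1 \<and> j = n then (\<lambda>k. c * basis_vec (n + 1) k)
      else if i = n \<and> j = n then (\<lambda>k. d * basis_vec (n + 1) k)
      else (\<lambda>_. 0))"

lemma L_table_iso_ext_algebra:
  assumes n: "n \<ge> 3"
  shows "table_algebra (n + 1) (L_table n b c d) \<cong> ext_algebra n 0 b c d"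
proof -
  \<comment> \<open>Move \<open>e\<^sub>2\<close> behind the chain \<open>e\<^sub>1, e\<^sub>3, \<dots>, e\<^sub>n\<close>.\<close>
  define \<sigma> where "\<sigma> i = (if i = 2 then n else if 3 \<le> i \<and> i \<le> n then i - 1 else i)" for i
  show ?thesis
    unfolding ext_algebra_def
  proof (rule table_algebra_permute[where \<sigma> = \<sigma>])
    show "bij_betw \<sigma> {1..n + 1} {1..n + 1}"
      by (rule bij_betw_byWitness[where f' = "\<lambda>i. if i = n then 2 else if 2 \<le> i \<and> i < n then i + 1 else i"])
        (use n in \<open>auto simp: \<sigma>_def\<close>)
  next
    fix i j k assume "i \<in> {1..n + 1}" "j \<in> {1..n + 1}" "k \<in> {1..n + 1}"
    note ijk = this
    have \<sigma>1: "\<sigma> i = 1 \<longleftrightarrow> i = 1" "\<sigma> j = 1 \<longleftrightarrow> j = 1" "\<sigma> i = n \<longleftrightarrow> i = 2" "\<sigma> j = n \<longleftrightarrow> j = 2"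
      "1 \<le> \<sigma> i \<and> \<sigma> i \<le> n - 2 \<longleftrightarrow> i = 1 \<or> 3 \<le> i \<and> i < n"
      using n ijk by (auto simp: \<sigma>_def)
    have \<sigma>2: "basis_vec (\<sigma> i + 1) (\<sigma> k) = basis_vec (if i = 1 then 3 else i + 1) k"
      if "i = 1 \<or> 3 \<le> i \<and> i < n"
      using n ijk that by (auto simp: \<sigma>_def basis_vec_def)
    have \<sigma>3: "basis_vec (n + 1) (\<sigma> k) = basis_vec (n + 1) k"
      using n ijk by (auto simp: \<sigma>_def basis_vec_def)
    show "L_table n b c d (\<sigma> i) (\<sigma> j) (\<sigma> k) = ext_table n 0 b c d i j k"
      unfolding L_table_def ext_table_def conj_assoc[symmetric] \<sigma>1
      using n \<sigma>2 \<sigma>3 by auto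
  qed (rule ext_table_support[OF n])
qed

lemma L1_par_iso: "n \<ge> 3 \<Longrightarrow> L1_par (n + 1) t \<cong> ext_algebra n 0 1 t 0"
proof -
  assume n: "n \<ge> 3"
  then have "L1_par (n + 1) t = table_algebra (n + 1) (L_table n 1 t 0)"
    unfolding L1_par_def by (intro arg_cong[where f = "table_algebra (n+1)"] ext) (auto simp: L_table_def)
  then show ?thesis using L_table_iso_ext_algebra[OF n] by simp
qed

lemma L2_par_iso: "n \<ge> 3 \<Longrightarrow> L2_par (n + 1) t \<cong> ext_algebra n 0 1 t 1"
proof -
  assume n: "n \<ge> 3"
  then have "L2_par (n + 1) t = table_algebra (n + 1) (L_table n 1 t 1)"
    unfolding L2_par_def by (intro arg_cong[where f = "table_algebra (n+1)"] ext) (auto simp: L_table_def)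
  then show ?thesis using L_table_iso_ext_algebra[OF n] by simp
qed

lemma L2_iso: "n \<ge> 3 \<Longrightarrow> L2 (n + 1) \<cong> ext_algebra n 0 0 1 0"
proof -
  assume n: "n \<ge> 3"
  then have "L2 (n + 1) = table_algebra (n + 1) (L_table n 0 1 0)"
    unfolding L2_def by (intro arg_cong[where f = "table_algebra (n+1)"] ext) (auto simp: L_table_def)
  then show ?thesis using L_table_iso_ext_algebra[OF n] by simp
qed

lemma direct_sum_iso:
  assumes n: "n \<ge> 3"
  shows "ext_algebra n 0 0 0 0 \<cong> direct_sum (F2 n 0 0) abelian1"
proof -
  define f :: "(nat \<Rightarrow> complex) \<Rightarrow> (nat \<Rightarrow> complex) \<times> complex"
    where "f z = (\<lambda>k. if k = n + 1 then 0 else z k, z (n + 1))" for z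
  have F2: "carrier (F2 n 0 0) = {x. \<forall>i. i \<notin> {1..n} \<longrightarrow> x i = 0}"
      "smul (F2 n 0 0) = (\<lambda>a x k. a * x k)"
    by (simp_all add: F2_def)
  have br: "bracket (F2 n 0 0) u w =
      (\<lambda>k. if k = 3 then u 1 * w 1 else if 4 \<le> k \<and> k \<le> n then u (k - 1) * w 1 else 0)"
    (is "_ = ?r") for u w
  proof
    fix k
    let ?c = "\<lambda>(i::nat) (j::nat). if i = 1 \<and> j = 1 then basis_vec 3
       else if 3 \<le> i \<and> i \<le> n - 1 \<and> j = 1 then basis_vec (i + 1)
       else if i = 1 \<and> j = 2 then (\<lambda>k. 0 * basis_vec n k)
       else if i = 2 \<and> j = 2 then (\<lambda>k. 0 * basis_vec n k) else (\<lambda>_. 0)"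
    let ?t = "\<lambda>i. u i * (w 1 * ?c i 1 k + w 2 * ?c i 2 k)"
    have *: "bracket (F2 n 0 0) u w k = (\<Sum>i=1..n. ?t i)"
      unfolding F2_def using n by (intro sum_two_columns) auto
    let ?S = "if k = 3 then {1} else if 4 \<le> k \<and> k \<le> n then {k - 1} else {}"
    have "(\<Sum>i=1..n. ?t i) = (\<Sum>i\<in>?S. ?t i)"
      using n by (intro sum.mono_neutral_right) (auto simp: basis_vec_def)
    also have "\<dots> = ?r k"
      using n by (auto simp: basis_vec_def)
    finally show "bracket (F2 n 0 0) u w k = ?r k" using * by simp
  qed
  have "alg_hom (ext_algebra n 0 0 0 0) (direct_sum (F2 n 0 0) abelian1) f"
    unfolding alg_hom_def direct_sum_def abelian1_def bracket_ext_algebra[OF n]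
    using n by (auto simp: F2 br f_def fun_eq_iff)
  moreover have "bij_betw f (carrier (ext_algebra n 0 0 0 0)) (carrier (direct_sum (F2 n 0 0) abelian1))"
    by (rule bij_betw_byWitness[where f' = "\<lambda>(z, a) k. if k = n + 1 then a else z k"])
      (auto simp: f_def direct_sum_def abelian1_def F2 fun_eq_iff)
  ultimately show ?thesis unfolding alg_iso_def by blast
qed

primrec structure_constants :: "ext_label \<Rightarrow> complex \<times> complex \<times> complex \<times> complex" where
  "structure_constants (F2_lab \<beta> \<gamma>) = (1, 0, \<beta>, \<gamma>)"
| "structure_constants (L1_par_lab t) = (0, 1, t, 0)"
| "structure_constants (L2_par_lab t) = (0, 1, t, 1)"
| "structure_constants L2_lab = (0, 0, 1, 0)"

lemma labelled_algebra_iso_ext_algebra: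
  assumes "n \<ge> 3" "structure_constants l = (a, b, c, d)"
  shows "labelled_algebra (n + 1) l \<cong> ext_algebra n a b c d"
    and "ext_algebra n a b c d \<cong> labelled_algebra (n + 1) l"
proof -
  show iso: "labelled_algebra (n + 1) l \<cong> ext_algebra n a b c d"
    using assms alg_iso_refl L1_par_iso L2_par_iso L2_iso F2_eq_ext_algebra by (cases l) auto
  have "closed_operations (labelled_algebra (n + 1) l)"
    using assms(1) by (cases l) (auto simp: F2_def L1_par_def L2_par_def L2_def basis_vec_def
        intro!: table_algebra_closed)
  with iso show "ext_algebra n a b c d \<cong> labelled_algebra (n + 1) l" by (rule alg_iso_sym)
qed

section \<open>Change of basis and normal forms\<close>

text \<open>
  The new basis is \<open>e\<^sub>1 + t e\<^sub>2\<close>, \<open>s (e\<^sub>2 - r e\<^sub>n)\<close>, \<open>w e\<^sub>n\<^sub>+\<^sub>1\<close>, together with \<open>e\<^sub>4, \<dots>, e\<^sub>n\<close> and the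
  square of the first vector, which is \<open>e\<^sub>3 + \<rho> e\<^sub>n\<^sub>+\<^sub>1\<close>. The later vectors of the chain do not
  change, because \<open>e\<^sub>n\<^sub>+\<^sub>1\<close> is central and \<open>e\<^sub>2\<close> multiplies the chain beyond \<open>e\<^sub>1\<close> by zero. The
  hypotheses multiply the new constants by \<open>w\<close> to avoid fractions.
\<close>

lemma ext_algebra_change_basis:
  assumes n: "n \<ge> 3" and s: "s \<noteq> 0" and w: "w \<noteq> 0"
    and a': "w * a' = a" and b': "w * b' = s * (b + t * d - r * a)"
    and c': "w * c' = s * (c + t * d)" and d': "w * d' = s\<^sup>2 * d"
  shows "ext_algebra n a' b' c' d' \<cong> ext_algebra n a b c d"
proof -
  define \<rho> where "\<rho> = t * (b + c) + t\<^sup>2 * d"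
  define f where "f z = (\<lambda>k. if k = n + 1 then w * z (n + 1) + \<rho> * z 3
      else if k = 2 then t * z 1 + s * z 2
      else if k = n then z n - s * r * z 2 else z k)" for z :: "nat \<Rightarrow> complex"
  \<comment> \<open>The inverse of \<open>f\<close>. When \<open>n = 3\<close>, the coordinate at \<open>3\<close> also contains the
    contribution of the second basis vector, and this has to be undone first.\<close>
  define g where "g z = (\<lambda>k. if k = n + 1 then (z (n + 1) - \<rho> * (if n = 3 then z 3 + r * (z 2 - t * z 1) else z 3)) / w
      else if k = 2 then (z 2 - t * z 1) / s
      else if k = n then z n + r * (z 2 - t * z 1) else z k)" for z :: "nat \<Rightarrow> complex"
  have "alg_hom (ext_algebra n a' b' c' d') (ext_algebra n a b c d) f"
    unfolding alg_hom_def
  proof (intro conjI ballI allI)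
    fix x y :: "nat \<Rightarrow> complex"
    have last: "w * (a' * x n * y 1 + b' * x 2 * y 1 + c' * x 1 * y 2 + d' * x 2 * y 2)
        + \<rho> * (x 1 * y 1)
        = a * (x n - s * r * x 2) * y 1 + b * (t * x 1 + s * x 2) * y 1
          + c * x 1 * (t * y 1 + s * y 2) + d * (t * x 1 + s * x 2) * (t * y 1 + s * y 2)"
    proof -
      have "w * (a' * x n * y 1 + b' * x 2 * y 1 + c' * x 1 * y 2 + d' * x 2 * y 2)
        = (w * a') * x n * y 1 + (w * b') * x 2 * y 1 + (w * c') * x 1 * y 2 + (w * d') * x 2 * y 2"
        by (simp add: algebra_simps)
      then show ?thesis
        unfolding a' b' c' d' \<rho>_def by (simp add: algebra_simps power2_eq_square)
    qed
    show "f (bracket (ext_algebra n a' b' c' d') x y) = bracket (ext_algebra n a b c d) (f x) (f y)"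
      using n last unfolding bracket_ext_algebra[OF n] by (auto simp: f_def fun_eq_iff)
  qed (use n in \<open>auto simp: f_def fun_eq_iff algebra_simps\<close>)
  moreover have "bij_betw f (carrier (ext_algebra n a' b' c' d')) (carrier (ext_algebra n a b c d))"
    by (rule bij_betw_byWitness[where f' = g])
      (use n s w in \<open>auto simp: f_def g_def fun_eq_iff field_simps\<close>)
  ultimately show ?thesis unfolding alg_iso_def by blast
qed

text \<open>
  If \<open>d \<noteq> 0\<close>, the parameter \<open>t\<close> can be used to make \<open>c\<close> vanish; if \<open>a \<noteq> 0\<close>, the parameter \<open>r\<close>
  then makes \<open>b\<close> vanish. The scalings \<open>s\<close> and \<open>w\<close> turn what remains into \<open>0\<close> or \<open>1\<close>, with a
  square root needed only for \<open>a d \<noteq> 0\<close>. For \<open>a = 0 \<noteq> d\<close> and \<open>b = c\<close> the representative in the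
  list is \<open>b = c = d = 1\<close> instead of \<open>b = c = 0\<close>, which are related by \<open>t\<close>. If \<open>a = d = 0\<close>, only the
  ratio of \<open>b\<close> and \<open>c\<close> is left.
\<close>

lemma ext_algebra_normal_form:
  assumes n: "n \<ge> 3"
  shows "ext_algebra n a b c d \<cong> ext_algebra n 0 0 0 0 \<or>
    (\<exists>l\<in>ext_labels. ext_algebra n a b c d \<cong> labelled_algebra (n + 1) l)"
proof -
  have norm: "\<exists>l\<in>ext_labels. ext_algebra n a b c d \<cong> labelled_algebra (n + 1) l"
    if "l \<in> ext_labels" "structure_constants l = (a', b', c', d')" "s \<noteq> 0" "w \<noteq> 0"
      "w * a' = a" "w * b' = s * (b + t * d - r * a)" "w * c' = s * (c + t * d)" "w * d' = s\<^sup>2 * d"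
    for l a' b' c' d' s t r w
  proof -
    have "ext_algebra n a b c d \<cong> ext_algebra n a' b' c' d'"
      using ext_algebra_change_basis[OF n that(3-8)] ext_algebra_closed[OF n] by (rule alg_iso_sym)
    also note labelled_algebra_iso_ext_algebra(2)[OF n that(2)]
    finally show ?thesis using that(1) by blast
  qed
  consider "a \<noteq> 0" "d \<noteq> 0" | "a \<noteq> 0" "d = 0" "c \<noteq> 0" | "a \<noteq> 0" "d = 0" "c = 0"
    | "a = 0" "d \<noteq> 0" "b = c" | "a = 0" "d \<noteq> 0" "b \<noteq> c"
    | "a = 0" "d = 0" "b \<noteq> 0" | "a = 0" "d = 0" "b = 0" "c \<noteq> 0" | "a = 0" "b = 0" "c = 0" "d = 0"
    by blast
  then show ?thesis
  proof cases
    case 1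
    have s: "(csqrt (a / d))\<^sup>2 * d = a" using 1 by simp
    show ?thesis
      by (rule disjI2, rule norm[of "F2_lab 0 1" _ _ _ _ "csqrt (a / d)" a "- c / d" "(b - c) / a"])
        (use 1 s in \<open>auto simp: ext_labels_def\<close>)
  next
    case 2
    show ?thesis
      by (rule disjI2, rule norm[of "F2_lab 1 0" _ _ _ _ "a / c" a 0 "b / a"])
        (use 2 in \<open>auto simp: ext_labels_def\<close>)
  next
    case 3
    show ?thesis
      by (rule disjI2, rule norm[of "F2_lab 0 0" _ _ _ _ 1 a 0 "b / a"])
        (use 3 in \<open>auto simp: ext_labels_def\<close>)
  next
    case 4
    show ?thesis
      by (rule disjI2, rule norm[of "L2_par_lab 1" _ _ _ _ 1 d "(d - b) / d" 0])
        (use 4 in \<open>auto simp: ext_labels_def field_simps\<close>)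
  next
    case 5
    show ?thesis
      by (rule disjI2, rule norm[of "L2_par_lab 0" _ _ _ _ "(b - c) / d" "(b - c)\<^sup>2 / d" "- c / d" 0])
        (use 5 in \<open>auto simp: ext_labels_def power2_eq_square\<close>)
  next
    case 6
    show ?thesis
      by (rule disjI2, rule norm[of "L1_par_lab (c / b)" _ _ _ _ 1 b 0 0])
        (use 6 in \<open>auto simp: ext_labels_def\<close>)
  next
    case 7
    show ?thesis
      by (rule disjI2, rule norm[of L2_lab _ _ _ _ 1 c 0 0])
        (use 7 in \<open>auto simp: ext_labels_def\<close>)
  next
    case 8
    then show ?thesis by (simp add: alg_iso_refl)
  qed
qed

section \<open>Central extensions belong to the family\<close>

context leibniz_algebra
begin

lemma zero_closed [simp]: "0 \<in> carrier L"
  using subspace_carrier by (rule subspace_0)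

lemma bracket_zero_left [simp]: "y \<in> carrier L \<Longrightarrow> bracket L 0 y = 0"
  using bracket_smul_left[of 0 y 0] by simp

lemma bracket_zero_right [simp]: "y \<in> carrier L \<Longrightarrow> bracket L y 0 = 0"
  using bracket_smul_right[of y 0 0] by simp

lemma smul_closed: "x \<in> carrier L \<Longrightarrow> smul L a x \<in> carrier L"
  using subspace_carrier by (rule subspace_scale)

lemma lincomb_closed:
  "(\<And>i. i \<in> I \<Longrightarrow> e i \<in> carrier L) \<Longrightarrow> (\<Sum>i\<in>I. smul L (z i) (e i)) \<in> carrier L"
  using subspace_carrier by (intro subspace_sum smul_closed)

lemma bracket_lincomb_left:
  assumes "finite I" "\<And>i. i \<in> I \<Longrightarrow> e i \<in> carrier L" "y \<in> carrier L"
  shows "bracket L (\<Sum>i\<in>I. smul L (z i) (e i)) y = (\<Sum>i\<in>I. smul L (z i) (bracket L (e i) y))"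
  using assms by (induction I rule: finite_induct)
    (simp_all add: bracket_add_left bracket_smul_left smul_closed lincomb_closed)

lemma bracket_lincomb_right:
  assumes "finite I" "\<And>i. i \<in> I \<Longrightarrow> e i \<in> carrier L" "y \<in> carrier L"
  shows "bracket L y (\<Sum>i\<in>I. smul L (z i) (e i)) = (\<Sum>i\<in>I. smul L (z i) (bracket L y (e i)))"
  using assms by (induction I rule: finite_induct)
    (simp_all add: bracket_add_right bracket_smul_right smul_closed lincomb_closed)

lemma lincomb_basis_vec:
  assumes "finite I" "i \<in> I"
  shows "(\<Sum>k\<in>I. smul L (a * basis_vec i k) (e k)) = smul L a (e i)"
proof -
  have "(\<Sum>k\<in>I. smul L (a * basis_vec i k) (e k)) = (\<Sum>k\<in>{i}. smul L (a * basis_vec i k) (e k))"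
    using assms by (intro sum.mono_neutral_right) (auto simp: basis_vec_def)
  then show ?thesis by (simp add: basis_vec_def)
qed

text \<open>
  An algebra is isomorphic to the coordinate algebra of any of its bases. Bilinearity extends
  the multiplication table from the basis to all linear combinations.
\<close>

lemma table_algebra_iso_of_basis:
  assumes e: "\<And>i. i \<in> {1..m} \<Longrightarrow> e i \<in> carrier L"
    and table: "\<And>i j. i \<in> {1..m} \<Longrightarrow> j \<in> {1..m} \<Longrightarrow>
      bracket L (e i) (e j) = (\<Sum>k=1..m. smul L (c i j k) (e k))"
    and indep: "\<And>z i. (\<Sum>k=1..m. smul L (z k) (e k)) = 0 \<Longrightarrow> i \<in> {1..m} \<Longrightarrow> z i = 0"
    and spanning: "\<And>u. u \<in> carrier L \<Longrightarrow> \<exists>z. u = (\<Sum>k=1..m. smul L (z k) (e k))"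
  shows "table_algebra m c \<cong> L"
proof -
  define \<Phi> where "\<Phi> z = (\<Sum>k=1..m. smul L (z k) (e k))" for z
  have \<Phi>_add: "\<Phi> (z + w) = \<Phi> z + \<Phi> w" for z w
    by (simp add: \<Phi>_def scale_left_distrib sum.distrib)
  have \<Phi>_smul: "\<Phi> (\<lambda>k. a * z k) = smul L a (\<Phi> z)" for a z
    by (simp add: \<Phi>_def scale_sum_right)
  have \<Phi>_closed: "\<Phi> z \<in> carrier L" for z
    unfolding \<Phi>_def using e by (rule lincomb_closed)
  have \<Phi>_bracket: "\<Phi> (bracket (table_algebra m c) z w) = bracket L (\<Phi> z) (\<Phi> w)" for z w
  proof -
    have "bracket L (\<Phi> z) (\<Phi> w)
        = (\<Sum>i=1..m. smul L (z i) (\<Sum>j=1..m. smul L (w j) (bracket L (e i) (e j))))"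
    proof -
      have "bracket L (\<Phi> z) (\<Phi> w) = (\<Sum>i=1..m. smul L (z i) (bracket L (e i) (\<Phi> w)))"
        unfolding \<Phi>_def[of z] using e \<Phi>_closed by (intro bracket_lincomb_left) auto
      also have "\<dots> = (\<Sum>i=1..m. smul L (z i) (\<Sum>j=1..m. smul L (w j) (bracket L (e i) (e j))))"
        unfolding \<Phi>_def using e by (intro sum.cong refl arg_cong[where f = "smul L _"] bracket_lincomb_right) auto
      finally show ?thesis .
    qed
    also have "\<dots> = (\<Sum>i=1..m. \<Sum>j=1..m. \<Sum>k=1..m. smul L (z i * w j * c i j k) (e k))"
      using table by (simp add: scale_sum_right mult.assoc)
    also have "\<dots> = (\<Sum>k=1..m. \<Sum>i=1..m. \<Sum>j=1..m. smul L (z i * w j * c i j k) (e k))"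
      by (rule trans[OF sum.cong[OF refl sum.swap] sum.swap])
    also have "\<dots> = \<Phi> (bracket (table_algebra m c) z w)"
      by (simp add: \<Phi>_def scale_sum_left)
    finally show ?thesis by simp
  qed
  have "alg_hom (table_algebra m c) L \<Phi>"
    unfolding alg_hom_def using \<Phi>_closed \<Phi>_add \<Phi>_smul \<Phi>_bracket by simp
  moreover have "bij_betw \<Phi> (carrier (table_algebra m c)) (carrier L)"
    unfolding bij_betw_def
  proof
    show "inj_on \<Phi> (carrier (table_algebra m c))"
    proof (rule inj_onI)
      fix z w assume zw: "z \<in> carrier (table_algebra m c)" "w \<in> carrier (table_algebra m c)" "\<Phi> z = \<Phi> w"
      then have "(\<Sum>k=1..m. smul L (z k - w k) (e k)) = 0"
        by (simp add: \<Phi>_def scale_left_diff_distrib sum_subtractf)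
      then have "z i - w i = 0" if "i \<in> {1..m}" for i
        using indep[of "\<lambda>k. z k - w k" i] that by simp
      then have "z i = w i" for i
        using zw by (cases "i \<in> {1..m}") auto
      then show "z = w" by blast
    qed
    show "\<Phi> ` carrier (table_algebra m c) = carrier L"
    proof (intro equalityI subsetI)
      fix u assume "u \<in> carrier L"
      then obtain z where z: "u = (\<Sum>k=1..m. smul L (z k) (e k))" using spanning by blast
      then have "u = \<Phi> (\<lambda>k. if k \<in> {1..m} then z k else 0)" by (simp add: \<Phi>_def)
      then show "u \<in> \<Phi> ` carrier (table_algebra m c)" by (rule image_eqI[where f = \<Phi>]) simp
    qed (use \<Phi>_closed in auto)
  qed
  ultimately show ?thesis unfolding alg_iso_def by blast
qed

end

lemma F2_bracket_basis_vec:
  assumes "i \<in> {1..n}" "j \<in> {1..n}"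
  shows "bracket (F2 n 0 0) (basis_vec i) (basis_vec j) =
    (if j = 1 \<and> i = 1 then basis_vec 3
     else if j = 1 \<and> 3 \<le> i \<and> i < n then basis_vec (i + 1) else 0)"
  unfolding F2_def bracket_basis_vec[OF assms] using assms by (auto simp: fun_eq_iff)

text \<open>
  Lift \<open>e\<^sub>1\<close> and \<open>e\<^sub>2\<close> to \<open>x\<close> and \<open>y\<close>, and lift the rest of the chain by the right powers of \<open>x\<close>.
  Together with a generator \<open>v\<close> of the kernel these form a basis, and all products of basis
  vectors except four are forced by the Leibniz identity. The four exceptions lie in the kernel
  and hence are multiples of \<open>v\<close>.
\<close>

lemma central_extension_is_ext_algebra:
  fixes V :: "'v::ab_group_add calgebra" and E :: "'e::ab_group_add calgebra"
  assumes ext: "central_extension 1 V E (F2 n 0 0) \<iota> \<pi>" and n: "n \<ge> 3"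
  shows "\<exists>a b c d. ext_algebra n a b c d \<cong> E"
proof -
  interpret central_extension 1 V E "F2 n 0 0" \<iota> \<pi> by (rule ext)
  have F2_simps: "carrier (F2 n 0 0) = {x. \<forall>i. i \<notin> {1..n} \<longrightarrow> x i = 0}"
      "smul (F2 n 0 0) = (\<lambda>a x k. a * x k)"
    by (simp_all add: F2_def)
  have \<iota>: "\<iota> z \<in> carrier E" "\<iota> (smul V a z) = smul E a (\<iota> z)"
    if "z \<in> carrier V" for a z
    using hom_\<iota> that by (auto simp: alg_hom_def)
  have \<pi>: "\<pi> u \<in> carrier (F2 n 0 0)" "\<pi> (u + w) = \<pi> u + \<pi> w" "\<pi> (smul E a u) = (\<lambda>k. a * \<pi> u k)"
      "\<pi> (bracket E u w) = bracket (F2 n 0 0) (\<pi> u) (\<pi> w)"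
    if "u \<in> carrier E" "w \<in> carrier E" for a u w
    using hom_\<pi> that by (auto simp: alg_hom_def F2_simps)
  have \<pi>0: "\<pi> 0 = 0"
    using \<pi>(2)[of 0 0] by simp

  obtain v0 where v0: "v0 \<in> carrier V" "v0 \<noteq> 0" "carrier V = range (\<lambda>a. smul V a v0)"
  proof -
    obtain B where B: "B \<subseteq> carrier V" "V.independent B" "carrier V \<subseteq> V.span B" "card B = 1"
      using V.basis_exists[of "carrier V"] dim_V by metis
    then obtain b where b: "B = {b}" by (metis card_1_singletonE)
    then have "b \<noteq> 0" using B(2) V.dependent_zero by blast
    moreover have "carrier V = range (\<lambda>a. smul V a b)"
      using B b V.span_singleton[of b] V.smul_closed by auto
    ultimately show thesis using that B(1) b by auto
  qed
  define v where "v = \<iota> v0"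
  have v: "v \<in> carrier E" "v \<noteq> 0"
  proof -
    show "v \<in> carrier E" using \<iota> v0 by (simp add: v_def)
    have "\<iota> 0 = 0" using \<iota>(2)[of v0 0] v0 by simp
    then show "v \<noteq> 0" using inj_\<iota> v0 V.zero_closed unfolding v_def by (metis inj_onD)
  qed
  have ker: "\<exists>a. u = smul E a v" if "u \<in> carrier E" "\<pi> u = 0" for u
  proof -
    have "u \<in> \<iota> ` carrier V" using that exact by simp
    then show ?thesis using v0 \<iota>(2)[of v0] by (auto simp: v_def)
  qed
  have kerc: "bracket E u w = 0" "bracket E w u = 0"
    if "u \<in> carrier E" "\<pi> u = 0" "w \<in> carrier E" for u w
    using that central exact by (auto simp: center_def)
  have \<pi>v: "\<pi> v = 0" using exact v0 by (auto simp: v_def)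

  have lift: "\<exists>x\<in>carrier E. \<pi> x = basis_vec i" if "i \<in> {1..n}" for i
  proof -
    have "basis_vec i \<in> carrier (F2 n 0 0)" using that by (auto simp: F2_simps basis_vec_def)
    then have "basis_vec i \<in> \<pi> ` carrier E" unfolding surj_\<pi> .
    then show ?thesis by (auto elim!: imageE)
  qed
  obtain x where x: "x \<in> carrier E" "\<pi> x = basis_vec 1" using lift[of 1] n by auto
  obtain y where y: "y \<in> carrier E" "\<pi> y = basis_vec 2" using lift[of 2] n by auto
  define ch where "ch j = ((\<lambda>u. bracket E u x) ^^ j) x" for j
  have ch0: "ch 0 = x" and chS: "\<And>j. ch (Suc j) = bracket E (ch j) x" by (simp_all add: ch_def)
  have ch: "ch j \<in> carrier E" for j
    by (induction j) (simp_all add: ch0 chS x E.bracket_closed)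
  have \<pi>ch: "\<pi> (ch j) = basis_vec (j + 2)" if "1 \<le> j" "j \<le> n - 2" for j
    using that
  proof (induction j)
    case (Suc j)
    show ?case
    proof (cases "j = 0")
      case True
      then show ?thesis using n x \<pi>(4)[OF x(1) x(1)] F2_bracket_basis_vec[of 1 n 1]
        by (simp add: chS ch0 numeral_3_eq_3)
    next
      case False
      then have "\<pi> (ch j) = basis_vec (j + 2)" using Suc by simp
      moreover have "j + 2 < n" using Suc.prems by linarith
      ultimately show ?thesis using x False \<pi>(4)[OF ch x(1), of j] F2_bracket_basis_vec[of "j + 2" n 1]
        by (simp add: chS)
    qed
  qed simp
  \<comment> \<open>By the Leibniz identity \<open>[u, [z, x]]\<close> is expressed through right multiplications by \<open>z\<close>,
    and for \<open>z = x\<close> the two terms cancel. Induction along the chain does the rest.\<close>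
  have right: "\<forall>u\<in>carrier E. bracket E u (ch j) = 0" if "j \<ge> 1" for j
    using that
  proof (induction j)
    case (Suc j)
    show ?case
    proof
      fix u assume u: "u \<in> carrier E"
      have eq: "bracket E u (ch (Suc j)) = bracket E (bracket E u (ch j)) x - bracket E (bracket E u x) (ch j)"
        unfolding chS using u ch x by (intro E.leibniz)
      show "bracket E u (ch (Suc j)) = 0"
      proof (cases "j = 0")
        case True
        then show ?thesis using eq by (simp add: ch0)
      next
        case False
        then show ?thesis using eq Suc.IH u x by (simp add: E.bracket_closed)
      qed
    qed
  qed simp
  \<comment> \<open>A higher power is \<open>[z, x]\<close>, and \<open>[[z, x], y] = [[z, y], x] - [z, [y, x]]\<close>, where
    \<open>[z, y]\<close> and \<open>[y, x]\<close> are central because their images in \<open>F\<^sub>n\<^sup>2\<close> vanish.\<close>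
  have chy: "bracket E (ch j) y = 0" if "1 \<le> j" "j \<le> n - 2" for j
  proof -
    from that(1) obtain i where i: "j = Suc i" by (cases j) auto
    have \<pi>i: "\<pi> (ch i) = basis_vec (if i = 0 then 1 else i + 2)"
      using \<pi>ch[of i] that i x by (simp add: ch0)
    have 1: "\<pi> (bracket E y x) = 0" "\<pi> (bracket E (ch i) y) = 0"
      using \<pi>(4)[OF y(1) x(1)] \<pi>(4)[OF ch[of i] y(1)] \<pi>i x y n that i
      by (auto simp: F2_bracket_basis_vec)
    have "bracket E (ch i) (bracket E y x)
        = bracket E (bracket E (ch i) y) x - bracket E (bracket E (ch i) x) y"
      using ch x y by (intro E.leibniz)
    moreover have "bracket E (ch i) (bracket E y x) = 0"
      using 1 ch x y by (intro kerc(2)) (auto intro: E.bracket_closed)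
    moreover have "bracket E (bracket E (ch i) y) x = 0"
      using 1 ch x y by (intro kerc(1)) (auto intro: E.bracket_closed)
    ultimately show ?thesis by (simp add: i chS)
  qed
  have in_ker: "\<exists>a. bracket E u w = smul E a v"
    if "u \<in> carrier E" "w \<in> carrier E" "bracket (F2 n 0 0) (\<pi> u) (\<pi> w) = 0" for u w
    using that \<pi>(4) by (intro ker E.bracket_closed) auto
  have "\<pi> (ch (n - 2)) = basis_vec n"
  proof -
    have n2: "n - 2 + 2 = n" "1 \<le> n - 2" using n by auto
    show ?thesis using \<pi>ch[of "n - 2"] unfolding n2(1) using n2(2) by simp
  qed
  then obtain a where a: "bracket E (ch (n - 2)) x = smul E a v"
    using in_ker[OF ch x(1), of "n - 2"] x n by (auto simp: F2_bracket_basis_vec)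
  obtain b where b: "bracket E y x = smul E b v"
    using in_ker[OF y(1) x(1)] x y n by (auto simp: F2_bracket_basis_vec)
  obtain c where c: "bracket E x y = smul E c v"
    using in_ker[OF x(1) y(1)] x y n by (auto simp: F2_bracket_basis_vec)
  obtain d where d: "bracket E y y = smul E d v"
    using in_ker[OF y(1) y(1)] y n by (auto simp: F2_bracket_basis_vec)

  define e where "e k = (if k = 2 then y else if k = n + 1 then v else ch (if k = 1 then 0 else k - 2))" for k
  have e: "e k \<in> carrier E" for k
    using ch y v by (simp add: e_def)
  have \<pi>e: "\<pi> (e k) = basis_vec k" if "k \<in> {1..n}" for k
  proof -
    from that consider "k = 1" | "k = 2" | "3 \<le> k" "k \<le> n" by force
    then show ?thesis
    proof cases
      case 3
      obtain j where "k = j + 2" using 3 by (intro that[of "k - 2"]) simp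
      then show ?thesis using 3 \<pi>ch[of j] by (simp add: e_def)
    qed (use n x y in \<open>auto simp: e_def ch0\<close>)
  qed
  have \<pi>_lincomb: "\<pi> (\<Sum>k\<in>I. smul E (z k) (e k)) i = (\<Sum>k\<in>I. z k * \<pi> (e k) i)" if "finite I" for z i I
    using that
    by (induction I rule: finite_induct) (simp_all add: \<pi>0 \<pi>(2) \<pi>(3)[OF e e] e E.lincomb_closed E.smul_closed)
  have \<pi>_sum: "\<pi> (\<Sum>k=1..n. smul E (z k) (e k)) i = (if i \<in> {1..n} then z i else 0)" for z i
  proof -
    have "\<pi> (\<Sum>k=1..n. smul E (z k) (e k)) i = (\<Sum>k=1..n. basis_vec i k * z k)"
      unfolding \<pi>_lincomb[OF finite_atLeastAtMost]
      by (rule sum.cong) (auto simp: \<pi>e basis_vec_def)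
    also have "\<dots> = (if i \<in> {1..n} then z i else 0)"
    proof (cases "i \<in> {1..n}")
      case False
      then have "(\<Sum>k=1..n. basis_vec i k * z k) = 0"
        by (intro sum.neutral) (auto simp: basis_vec_def)
      then show ?thesis using False by (simp del: atLeastAtMost_iff)
    qed (simp add: sum_basis_vec)
    finally show ?thesis .
  qed
  have e_last: "e (n + 1) = v" using n by (simp add: e_def)
  have "table_algebra (n + 1) (ext_table n a b c d) \<cong> E"
  proof (rule E.table_algebra_iso_of_basis)
    fix i j assume i: "i \<in> {1..n+1}" and j: "j \<in> {1..n+1}"
    have lin: "(\<Sum>k=1..n+1. smul E (q * basis_vec r k) (e k)) = smul E q (e r)"
      if "r \<in> {1..n+1}" for q r
      using that by (intro E.lincomb_basis_vec) auto
    have lin1: "(\<Sum>k=1..n+1. smul E (basis_vec r k) (e k)) = e r"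
      if "r \<in> {1..n+1}" for r
      using lin[OF that, of 1] by simp
    have rhs: "(\<Sum>k=1..n+1. smul E (ext_table n a b c d i j k) (e k)) =
      (if i = 1 \<and> j = 1 then e 3
      else if 3 \<le> i \<and> i < n \<and> j = 1 then e (i + 1)
      else if i = n \<and> j = 1 then smul E a v
      else if i = 2 \<and> j = 1 then smul E b v
      else if i = 1 \<and> j = 2 then smul E c v
      else if i = 2 \<and> j = 2 then smul E d v
      else 0)"
      using n lin[of "n + 1"] lin1 by (simp add: ext_table_def e_last[simplified] del: sum.cl_ivl_Suc)
    have ei: "e 1 = x" "e 2 = y" "\<And>k. 3 \<le> k \<Longrightarrow> k \<le> n \<Longrightarrow> e k = ch (k - 2)"
      using n by (auto simp: e_def ch0)
    consider (last) "i = n + 1 \<or> j = n + 1" | (chain) "3 \<le> j" "j \<le> n" "i \<le> n"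
      | (one) "i = 1" "j = 1" | (two) "i = 1" "j = 2" | (three) "i = 2" "j = 1" | (four) "i = 2" "j = 2"
      | (five) "3 \<le> i" "i < n" "j = 1" | (six) "i = n" "j = 1" | (seven) "3 \<le> i" "i \<le> n" "j = 2"
    proof atomize_elim
      have "i = 1 \<or> i = 2 \<or> 3 \<le> i \<and> i < n \<or> i = n \<or> i = n + 1"
        using i n by auto
      moreover have "j = 1 \<or> j = 2 \<or> 3 \<le> j \<and> j \<le> n \<or> j = n + 1"
        using j n by auto
      ultimately show "(i = n + 1 \<or> j = n + 1) \<or> 3 \<le> j \<and> j \<le> n \<and> i \<le> n \<or> i = 1 \<and> j = 1 \<or>
          i = 1 \<and> j = 2 \<or> i = 2 \<and> j = 1 \<or> i = 2 \<and> j = 2 \<or> 3 \<le> i \<and> i < n \<and> j = 1 \<or>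
          i = n \<and> j = 1 \<or> 3 \<le> i \<and> i \<le> n \<and> j = 2"
        using n by (elim disjE) simp_all
    qed
    then show "bracket E (e i) (e j) = (\<Sum>k=1..n+1. smul E (ext_table n a b c d i j k) (e k))"
    proof cases
      case last
      then have "bracket E (e i) (e j) = 0" using kerc[OF v(1) \<pi>v] e e_last by auto
      moreover have "\<not> (i = 1 \<and> j = 1)" "\<not> (3 \<le> i \<and> i < n \<and> j = 1)" "\<not> (i = n \<and> j = 1)"
        "\<not> (i = 2 \<and> j = 1)" "\<not> (i = 1 \<and> j = 2)" "\<not> (i = 2 \<and> j = 2)"
        using last n by auto
      ultimately show ?thesis unfolding rhs by (simp only: if_False)
    next
      case chain
      then have "bracket E (e i) (e j) = 0" using ei(3) right e by simp
      with chain show ?thesis unfolding rhs by auto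
    next
      case one
      then show ?thesis unfolding rhs using n ei chS[of 0] ch0 by simp
    next
      case two
      then show ?thesis unfolding rhs using n ei c by simp
    next
      case three
      then show ?thesis unfolding rhs using n ei b by simp
    next
      case four
      then show ?thesis unfolding rhs using n ei d by simp
    next
      case five
      moreover have "i + 1 - 2 = Suc (i - 2)" using five by simp
      ultimately show ?thesis unfolding rhs using ei(1) ei(3)[of i] ei(3)[of "i + 1"] chS[of "i - 2"]
        by simp
    next
      case six
      then show ?thesis unfolding rhs using n ei(1) ei(3)[of n] a by simp
    next
      case seven
      then show ?thesis unfolding rhs using ei(2) ei(3)[of i] chy[of "i - 2"] by auto
    qed
  next
    fix z i assume z: "(\<Sum>k=1..n+1. smul E (z k) (e k)) = 0" and i: "i \<in> {1..n+1}"
    then have eq: "(\<Sum>k=1..n. smul E (z k) (e k)) + smul E (z (n + 1)) v = 0"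
      using e_last by simp
    have "\<pi> ((\<Sum>k=1..n. smul E (z k) (e k)) + smul E (z (n + 1)) v)
        = \<pi> (\<Sum>k=1..n. smul E (z k) (e k)) + \<pi> (smul E (z (n + 1)) v)"
      using e v by (intro \<pi>(2) E.lincomb_closed E.smul_closed)
    moreover have "\<pi> (smul E (z (n + 1)) v) = 0" 
      using v \<pi>v by (simp add: \<pi>(3)[OF v(1) v(1)] fun_eq_iff)
    ultimately have "\<pi> (\<Sum>k=1..n. smul E (z k) (e k)) = 0"
      using eq \<pi>0 by simp
    then have z0: "z i = 0" if "i \<in> {1..n}" for i
      using \<pi>_sum[of z i] that by simp
    then have "smul E (z (n + 1)) v = 0" using eq by simp
    then have "z (n + 1) = 0" using v by simp
    with z0 i show "z i = 0" by (cases "i = n + 1") auto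
  next
    fix u assume u: "u \<in> carrier E"
    define s where "s = (\<Sum>k=1..n. smul E (\<pi> u k) (e k))"
    have s: "s \<in> carrier E" unfolding s_def using e by (intro E.lincomb_closed)
    have us: "u - s \<in> carrier E" using E.subspace_carrier u s by (rule E.subspace_diff)
    have "\<pi> s = \<pi> u"
      using \<pi>_sum[of "\<pi> u"] \<pi>(1)[OF u u] by (auto simp: s_def fun_eq_iff F2_simps)
    moreover have "\<pi> u = \<pi> (u - s) + \<pi> s" using \<pi>(2)[OF us s] by simp
    ultimately have "\<pi> (u - s) = 0" by simp
    then obtain q where "u - s = smul E q v" using ker[OF us] by blast
    then have "u = s + smul E q v" by (simp add: algebra_simps)
    also have "\<dots> = (\<Sum>k=1..n+1. smul E (if k = n + 1 then q else \<pi> u k) (e k))"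
      using e_last by (simp add: s_def)
    finally show "\<exists>z. u = (\<Sum>k=1..n+1. smul E (z k) (e k))" by (intro exI)
  qed (rule e)
  then show ?thesis unfolding ext_algebra_def by blast
qed

section \<open>Isomorphism invariants\<close>

text \<open>
  Each of the following properties is invariant under isomorphism. For the algebras of the family,
  the lemmas below express it by the vanishing of the constants \<open>a, b, c, d\<close> or by a relation
  between them.
\<close>

definition has_nonzero_power :: "nat \<Rightarrow> 'a::zero calgebra \<Rightarrow> bool" where
  "has_nonzero_power k A \<longleftrightarrow> (\<exists>x\<in>carrier A. ((\<lambda>u. bracket A u x) ^^ k) x \<noteq> 0)"

text \<open>
  Two products are allowed because the center of a non-split extension with \<open>a = 0\<close> is spanned by
  \<open>e\<^sub>n\<close> and \<open>e\<^sub>n\<^sub>+\<^sub>1\<close>, and a linear combination of these need not be a single product.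
\<close>

definition has_central_non_product :: "'a::{zero,plus} calgebra \<Rightarrow> bool" where
  "has_central_non_product A \<longleftrightarrow>
     (\<exists>u\<in>center A. \<forall>p\<in>carrier A. \<forall>q\<in>carrier A. \<forall>r\<in>carrier A. \<forall>s\<in>carrier A.
        u \<noteq> bracket A p q + bracket A r s)"

definition square_zero_right_annihilates :: "'a::zero calgebra \<Rightarrow> bool" where
  "square_zero_right_annihilates A \<longleftrightarrow>
     (\<forall>y\<in>carrier A. bracket A y y = 0 \<longrightarrow> (\<forall>w\<in>carrier A. bracket A w y = 0))"

text \<open>
  In \<open>L\<^sub>m\<^sup>1\<^sup>,\<^sup>q\<close> the vector \<open>e\<^sub>m\<^sub>-\<^sub>1\<close> has this property, which makes the parameter of this family
  an invariant when it is not zero.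
\<close>

definition has_proportional_multiplications :: "complex \<Rightarrow> 'a::zero calgebra \<Rightarrow> bool" where
  "has_proportional_multiplications q A \<longleftrightarrow>
     (\<exists>y\<in>carrier A. bracket A y y = 0 \<and>
        (\<forall>w\<in>carrier A. bracket A w y = smul A q (bracket A y w)) \<and>
        (\<exists>w\<in>carrier A. bracket A y w \<noteq> 0))"

definition planes_meet_null_cone :: "'a::{zero,plus} calgebra \<Rightarrow> bool" where
  "planes_meet_null_cone A \<longleftrightarrow>
     (\<forall>y\<in>carrier A. \<forall>z\<in>carrier A. \<exists>s t. (s \<noteq> 0 \<or> t \<noteq> 0) \<and>
        bracket A (smul A s y + smul A t z) (smul A s y + smul A t z) = 0)"

definition has_commuting_non_null :: "'a::zero calgebra \<Rightarrow> bool" where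
  "has_commuting_non_null A \<longleftrightarrow>
     (\<exists>y\<in>carrier A. bracket A y y \<noteq> 0 \<and> (\<forall>w\<in>carrier A. bracket A y w = bracket A w y))"

lemma alg_isoE:
  fixes A :: "'a::ab_group_add calgebra" and B :: "'b::ab_group_add calgebra"
  assumes "A \<cong> B" "closed_operations A"
  obtains f where "carrier B = f ` carrier A" "inj_on f (carrier A)"
    "\<And>x y. x \<in> carrier A \<Longrightarrow> y \<in> carrier A \<Longrightarrow> f (x + y) = f x + f y"
    "\<And>a x. x \<in> carrier A \<Longrightarrow> f (smul A a x) = smul B a (f x)"
    "\<And>x y. x \<in> carrier A \<Longrightarrow> y \<in> carrier A \<Longrightarrow> f (bracket A x y) = bracket B (f x) (f y)"
    "\<And>x. x \<in> carrier A \<Longrightarrow> f x = 0 \<longleftrightarrow> x = 0"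
proof -
  obtain f where f: "alg_hom A B f" and bij: "bij_betw f (carrier A) (carrier B)"
    using assms(1) unfolding alg_iso_def by blast
  have 0: "0 \<in> carrier A" using assms(2) by (simp add: closed_operations_def)
  have "f (0 + 0) = f 0 + f 0" using f 0 unfolding alg_hom_def by blast
  then have f0: "f 0 = 0" by simp
  have inj: "inj_on f (carrier A)" using bij by (simp add: bij_betw_def)
  show thesis
  proof (rule that[of f])
    show "f x = 0 \<longleftrightarrow> x = 0" if "x \<in> carrier A" for x
      using inj_onD[OF inj, of x 0] f0 0 that by auto
  qed (use f bij in \<open>auto simp: alg_hom_def bij_betw_def\<close>)
qed

text \<open>
  An isomorphism carries a witness, or a counterexample, to its image, because each property is
  built from the operations and equations between elements only.
\<close>

lemma iso_invariants:
  fixes A :: "'a::ab_group_add calgebra" and B :: "'b::ab_group_add calgebra"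
  assumes iso: "A \<cong> B" and A: "closed_operations A"
  shows "has_nonzero_power k A \<Longrightarrow> has_nonzero_power k B"
    and "has_central_non_product A \<Longrightarrow> has_central_non_product B"
    and "square_zero_right_annihilates A \<Longrightarrow> square_zero_right_annihilates B"
    and "has_proportional_multiplications q A \<Longrightarrow> has_proportional_multiplications q B"
    and "planes_meet_null_cone A \<Longrightarrow> planes_meet_null_cone B"
    and "has_commuting_non_null A \<Longrightarrow> has_commuting_non_null B"
proof -
  obtain f where B: "carrier B = f ` carrier A" and inj: "inj_on f (carrier A)"
    and add: "\<And>x y. x \<in> carrier A \<Longrightarrow> y \<in> carrier A \<Longrightarrow> f x + f y = f (x + y)"
    and smul: "\<And>a x. x \<in> carrier A \<Longrightarrow> smul B a (f x) = f (smul A a x)"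
    and bracket: "\<And>x y. x \<in> carrier A \<Longrightarrow> y \<in> carrier A \<Longrightarrow> bracket B (f x) (f y) = f (bracket A x y)"
    and zero: "\<And>x. x \<in> carrier A \<Longrightarrow> f x = 0 \<longleftrightarrow> x = 0"
    using alg_isoE[OF iso A] by metis
  have closed: "0 \<in> carrier A" "\<And>x y. x \<in> carrier A \<Longrightarrow> y \<in> carrier A \<Longrightarrow> x + y \<in> carrier A"
    "\<And>x y. x \<in> carrier A \<Longrightarrow> y \<in> carrier A \<Longrightarrow> bracket A x y \<in> carrier A"
    "\<And>a x. x \<in> carrier A \<Longrightarrow> smul A a x \<in> carrier A"
    using A by (auto simp: closed_operations_def)
  have eq: "f x = f y \<longleftrightarrow> x = y" if "x \<in> carrier A" "y \<in> carrier A" for x y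
    using inj that by (auto dest: inj_onD)
  note transfer = B closed add smul bracket zero eq
  have power: "((\<lambda>u. bracket A u x) ^^ k) x \<in> carrier A \<and>
      ((\<lambda>u. bracket B u (f x)) ^^ k) (f x) = f (((\<lambda>u. bracket A u x) ^^ k) x)"
    if "x \<in> carrier A" for k x
    using that by (induction k) (simp_all add: transfer)
  show "has_nonzero_power k A \<Longrightarrow> has_nonzero_power k B"
    unfolding has_nonzero_power_def using power by (auto simp: B zero)
  have "center B = f ` center A"
    unfolding center_def by (auto simp: transfer)
  then show "has_central_non_product A \<Longrightarrow> has_central_non_product B"
    unfolding has_central_non_product_def by (auto simp: transfer center_def)
  show "square_zero_right_annihilates A \<Longrightarrow> square_zero_right_annihilates B"
    unfolding square_zero_right_annihilates_def by (simp add: transfer)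
  show "has_proportional_multiplications q A \<Longrightarrow> has_proportional_multiplications q B"
    unfolding has_proportional_multiplications_def by (simp add: transfer)
  show "planes_meet_null_cone A \<Longrightarrow> planes_meet_null_cone B"
    unfolding planes_meet_null_cone_def by (simp add: transfer)
  show "has_commuting_non_null A \<Longrightarrow> has_commuting_non_null B"
    unfolding has_commuting_non_null_def by (simp add: transfer)
qed

lemma coordinate_nonzero_imp_nonzero: "f (i::nat) \<noteq> (0::complex) \<Longrightarrow> f \<noteq> 0"
  by auto

context
  fixes n :: nat
  assumes n: "n \<ge> 3"
begin

lemma basis_vec_in_ext_algebra: "1 \<le> i \<Longrightarrow> i \<le> n + 1 \<Longrightarrow> basis_vec i \<in> carrier (ext_algebra n a b c d)"
  by (auto simp: basis_vec_def)

text \<open>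
  The powers of \<open>e\<^sub>1\<close> run through \<open>e\<^sub>3, \<dots>, e\<^sub>n, a e\<^sub>n\<^sub>+\<^sub>1\<close>. If \<open>a = 0\<close>, each multiplication pushes
  an arbitrary element one step further along the chain, and \<open>e\<^sub>n\<^sub>+\<^sub>1\<close> can be reached from \<open>e\<^sub>1\<close> and
  \<open>e\<^sub>2\<close> only, that is, in a single step.
\<close>

lemma has_nonzero_power_ext_algebra:
  assumes "a = 0 \<or> b = 0"
  shows "has_nonzero_power (n - 1) (ext_algebra n a b c d) \<longleftrightarrow> a \<noteq> 0"
proof
  let ?A = "ext_algebra n a b c d"
  define pow where "pow k x = ((\<lambda>u. bracket ?A u x) ^^ k) x" for k x
  have pow0: "pow 0 x = x" and powS: "pow (Suc k) x = bracket ?A (pow k x) x" for k x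
    by (simp_all add: pow_def)
  note br = bracket_ext_algebra[OF n]
  obtain k0 where k0: "n - 1 = Suc (Suc k0)" using n by (intro that[of "n - 3"]) simp
  show "a \<noteq> 0" if hyp: "has_nonzero_power (n - 1) ?A"
  proof
    assume a: "a = 0"
    obtain x where x: "x \<in> carrier ?A" "pow (n - 1) x \<noteq> 0"
      using hyp unfolding has_nonzero_power_def pow_def by blast
    have low: "\<forall>i. i \<le> k + 2 \<and> i \<le> n \<longrightarrow> pow (Suc k) x i = 0" for k
    proof (induction k)
      case 0
      then show ?case using n by (simp add: powS[of 0] br)
    next
      case (Suc k)
      have "pow (Suc k) x (i - 1) = 0" if "i \<le> Suc k + 2" "i \<le> n" for i
      proof -
        have "i - 1 \<le> k + 2" "i - 1 \<le> n" using that by linarith+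
        with Suc.IH show ?thesis by blast
      qed
      then show ?case using Suc by (simp add: powS[of "Suc k"] br)
    qed
    have "pow (Suc (Suc k0)) x = 0"
    proof
      fix i
      show "pow (Suc (Suc k0)) x i = 0 i"
      proof (cases "i \<le> n")
        case True
        then show ?thesis using low[of "Suc k0"] k0 by simp
      next
        case False
        then show ?thesis using low[of k0] n a by (simp add: powS[of "Suc k0"] br)
      qed
    qed
    with x k0 show False by simp
  qed
  show "has_nonzero_power (n - 1) ?A" if a: "a \<noteq> 0"
  proof -
    have b: "b = 0" using assms a by simp
    have "pow (Suc k) (basis_vec 1) (k + 3) \<noteq> 0" if "k + 2 \<le> n" for k
      using that
    proof (induction k)
      case 0
      then show ?case by (simp add: powS pow0 br basis_vec_def)
    next
      case (Suc k)
      then have IH: "pow (Suc k) (basis_vec 1) (k + 3) \<noteq> 0" by simp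
      show ?case
      proof (cases "k + 4 \<le> n")
        case True
        then show ?thesis using IH
          by (simp add: powS[of "Suc k"] br basis_vec_def numeral_eq_Suc)
      next
        case False
        then have k: "k + 3 = n" "Suc k + 3 = n + 1" using Suc.prems by simp_all
        show ?thesis using IH a b n unfolding k
          by (simp add: powS[of "Suc k"] br basis_vec_def)
      qed
    qed
    from this[of "Suc k0"] have "pow (n - 1) (basis_vec 1) \<noteq> 0"
      using n k0 coordinate_nonzero_imp_nonzero by fastforce
    then show ?thesis
      unfolding has_nonzero_power_def pow_def using basis_vec_in_ext_algebra[of 1] n by auto
  qed
qed

text \<open>
  If \<open>b = c = d = 0\<close>, then \<open>e\<^sub>2\<close> is central and no product has a component along it. Otherwise
  a central element has no component along \<open>e\<^sub>2\<close>, so it is a combination of \<open>e\<^sub>n\<close>, which is a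
  product inside the chain, and \<open>e\<^sub>n\<^sub>+\<^sub>1\<close>, which is a multiple of a product by whichever of
  \<open>b, c, d\<close> is not zero.
\<close>

lemma has_central_non_product_ext_algebra:
  assumes "a = 0 \<or> b = 0"
  shows "has_central_non_product (ext_algebra n a b c d) \<longleftrightarrow> b = 0 \<and> c = 0 \<and> d = 0"
proof
  let ?A = "ext_algebra n a b c d"
  note br = bracket_ext_algebra[OF n]
  have e: "basis_vec 1 \<in> carrier ?A" "basis_vec 2 \<in> carrier ?A"
    using n basis_vec_in_ext_algebra by simp_all
  show "has_central_non_product ?A" if 0: "b = 0 \<and> c = 0 \<and> d = 0"
  proof -
    have "basis_vec 2 \<in> center ?A"
      using n 0 e(2) by (auto simp: center_def br basis_vec_def fun_eq_iff)
    moreover have "basis_vec 2 \<noteq> bracket ?A p q + bracket ?A r s" for p q r s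
    proof
      assume "basis_vec 2 = bracket ?A p q + bracket ?A r s"
      from fun_cong[OF this, of 2] show False using n by (simp add: br basis_vec_def)
    qed
    ultimately show ?thesis unfolding has_central_non_product_def by blast
  qed
  show "b = 0 \<and> c = 0 \<and> d = 0" if hyp: "has_central_non_product ?A"
  proof (rule ccontr)
    assume nz: "\<not> (b = 0 \<and> c = 0 \<and> d = 0)"
    obtain u where u: "u \<in> center ?A" and
      non: "\<And>p q r s. p \<in> carrier ?A \<Longrightarrow> q \<in> carrier ?A \<Longrightarrow> r \<in> carrier ?A \<Longrightarrow> s \<in> carrier ?A
        \<Longrightarrow> u \<noteq> bracket ?A p q + bracket ?A r s"
      using hyp unfolding has_central_non_product_def by blast
    have uc: "i \<notin> {1..n+1} \<Longrightarrow> u i = 0" for i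
      using u by (simp add: center_def)
    have z: "bracket ?A u (basis_vec 1) k = 0" "bracket ?A (basis_vec 1) u k = 0"
      "bracket ?A (basis_vec 2) u k = 0" for k
      using u e(1) e(2) n by (auto simp: center_def)
    have u1: "u 1 = 0" using z(1)[of 3] by (simp add: br basis_vec_def)
    have uk: "u k = 0" if "3 \<le> k" "k < n" for k
      using z(1)[of "k + 1"] that by (simp add: br basis_vec_def)
    have u2: "u 2 = 0"
    proof (rule ccontr)
      assume u2: "u 2 \<noteq> 0"
      have "c = 0" "d = 0" using z(2)[of "n + 1"] z(3)[of "n + 1"] u1 u2 n
        by (simp_all add: br basis_vec_def)
      moreover have "a * u n + b * u 2 = 0" using z(1)[of "n + 1"] n by (simp add: br basis_vec_def)
      ultimately show False using nz u2 assms by auto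
    qed
    \<comment> \<open>The predecessor of \<open>e\<^sub>n\<close> in the chain is \<open>e\<^sub>1\<close> when \<open>n = 3\<close>, since the chain omits \<open>e\<^sub>2\<close>.\<close>
    define p where "p = (\<lambda>k. u n * basis_vec (if n = 3 then 1 else n - 1) k)"
    have p: "p \<in> carrier ?A" using n by (auto simp: p_def basis_vec_def)
    have pe: "bracket ?A p (basis_vec 1) k = (if k = n then u n else 0)" for k
      using n by (auto simp: br p_def basis_vec_def)
    have "\<exists>r\<in>carrier ?A. \<exists>s\<in>carrier ?A. \<forall>k. bracket ?A r s k = (if k = n + 1 then u (n + 1) else 0)"
    proof -
      have sc: "(\<lambda>k. q * basis_vec 2 k) \<in> carrier ?A" for q
        using n by (auto simp: basis_vec_def)
      consider "b \<noteq> 0" | "c \<noteq> 0" | "d \<noteq> 0" using nz by blast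
      then show ?thesis
      proof cases
        case 1
        then show ?thesis using n
          by (intro bexI[OF _ sc[of "u (n + 1) / b"]] bexI[OF _ e(1)]) (auto simp: br basis_vec_def)
      next
        case 2
        then show ?thesis using n
          by (intro bexI[OF _ e(1)] bexI[OF _ sc[of "u (n + 1) / c"]]) (auto simp: br basis_vec_def)
      next
        case 3
        then show ?thesis using n
          by (intro bexI[OF _ e(2)] bexI[OF _ sc[of "u (n + 1) / d"]]) (auto simp: br basis_vec_def)
      qed
    qed
    then obtain r s where rs: "r \<in> carrier ?A" "s \<in> carrier ?A"
      and rsk: "\<And>k. bracket ?A r s k = (if k = n + 1 then u (n + 1) else 0)" by blast
    have "u = bracket ?A p (basis_vec 1) + bracket ?A r s"
    proof
      fix k
      consider "k = 1" | "k = 2" | "3 \<le> k" "k < n" | "k = n" | "k = n + 1" | "k \<notin> {1..n+1}"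
        by force
      then show "u k = (bracket ?A p (basis_vec 1) + bracket ?A r s) k"
        using u1 u2 uk uc n by cases (auto simp: pe rsk simp del: One_nat_def)
    qed
    with non[OF p e(1) rs] n show False by simp
  qed
qed

text \<open>
  An element \<open>y\<close> squares to zero exactly when \<open>y\<^sub>1 = 0\<close> and \<open>d y\<^sub>2\<^sup>2 = 0\<close>, and the products
  \<open>[w, y]\<close> then reduce to \<open>c w\<^sub>1 y\<^sub>2 e\<^sub>n\<^sub>+\<^sub>1\<close>.
\<close>

lemma square_zero_right_annihilates_ext_algebra:
  "square_zero_right_annihilates (ext_algebra n a b c d) \<longleftrightarrow> c = 0 \<or> d \<noteq> 0"
proof
  let ?A = "ext_algebra n a b c d"
  note br = bracket_ext_algebra[OF n]
  have e: "basis_vec 1 \<in> carrier ?A" "basis_vec 2 \<in> carrier ?A"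
    using n basis_vec_in_ext_algebra by simp_all
  show "c = 0 \<or> d \<noteq> 0" if sq: "square_zero_right_annihilates ?A"
  proof (rule ccontr)
    assume cd: "\<not> (c = 0 \<or> d \<noteq> 0)"
    then have "bracket ?A (basis_vec 2) (basis_vec 2) = 0"
      using n by (auto simp: br basis_vec_def fun_eq_iff)
    then have "bracket ?A (basis_vec 1) (basis_vec 2) = 0"
      using sq e(1) e(2) n by (simp add: square_zero_right_annihilates_def)
    from fun_cong[OF this, of "n + 1"] show False
      using cd n by (simp add: br basis_vec_def)
  qed
  show "square_zero_right_annihilates ?A" if cd: "c = 0 \<or> d \<noteq> 0"
    unfolding square_zero_right_annihilates_def
  proof (intro ballI impI)
    fix y w assume y: "bracket ?A y y = 0"
    have "y 1 = 0" using fun_cong[OF y, of 3] by (simp add: br)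
    moreover have "c = 0 \<and> d = 0 \<or> y 2 = 0"
      using fun_cong[OF y, of "n + 1"] calculation cd n by (auto simp: br)
    ultimately show "bracket ?A w y = 0" by (auto simp: br fun_eq_iff)
  qed
qed

text \<open>
  If \<open>y\<close> squares to zero, then \<open>y\<^sub>1 = 0\<close>, so \<open>[e\<^sub>1, y]\<close> is a multiple of \<open>e\<^sub>n\<^sub>+\<^sub>1\<close>. As \<open>q \<noteq> 0\<close>,
  so is \<open>[y, e\<^sub>1]\<close>, and this confines \<open>y\<close> to the span of \<open>e\<^sub>2, e\<^sub>n, e\<^sub>n\<^sub>+\<^sub>1\<close>. Comparing the
  two products gives \<open>c y\<^sub>2 = q b y\<^sub>2\<close>. For \<open>q = 0\<close> the argument breaks down, as \<open>e\<^sub>3\<close> is then a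
  witness whenever \<open>n > 3\<close>.
\<close>

lemma has_proportional_multiplications_ext_algebra:
  assumes "q \<noteq> 0"
  shows "has_proportional_multiplications q (ext_algebra n 0 b c d) \<longleftrightarrow> b \<noteq> 0 \<and> c = q * b \<and> d = 0"
proof
  let ?A = "ext_algebra n 0 b c d"
  note br = bracket_ext_algebra[OF n]
  have e: "basis_vec 1 \<in> carrier ?A" "basis_vec 2 \<in> carrier ?A"
    using n basis_vec_in_ext_algebra by simp_all
  show "has_proportional_multiplications q ?A" if bcd: "b \<noteq> 0 \<and> c = q * b \<and> d = 0"
    unfolding has_proportional_multiplications_def
  proof (rule bexI[OF _ e(2)], intro conjI ballI)
    show "\<exists>w\<in>carrier ?A. bracket ?A (basis_vec 2) w \<noteq> 0"
      using n bcd by (intro bexI[OF _ e(1)] coordinate_nonzero_imp_nonzero[of _ "n + 1"]) (auto simp: br basis_vec_def)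
  qed (use n bcd in \<open>auto simp: br basis_vec_def fun_eq_iff\<close>)
  show "b \<noteq> 0 \<and> c = q * b \<and> d = 0" if hyp: "has_proportional_multiplications q ?A"
  proof -
    obtain y w where y: "y \<in> carrier ?A" "bracket ?A y y = 0"
      and proportional: "\<And>w. w \<in> carrier ?A \<Longrightarrow> bracket ?A w y = smul ?A q (bracket ?A y w)"
      and w: "bracket ?A y w \<noteq> 0"
      using hyp unfolding has_proportional_multiplications_def by blast
    have y1: "y 1 = 0" using fun_cong[OF y(2), of 3] by (simp add: br)
    have dy: "d * y 2 = 0" using fun_cong[OF y(2), of "n + 1"] y1 n by (auto simp: br)
    have eq: "bracket ?A (basis_vec 1) y k = q * bracket ?A y (basis_vec 1) k" for k
      using fun_cong[OF proportional[OF e(1)], of k] n by simp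
    have yk: "y k = 0" if "3 \<le> k" "k < n" for k
      using eq[of "k + 1"] that y1 assms by (simp add: br basis_vec_def)
    have cy: "c * y 2 = q * b * y 2"
      using eq[of "n + 1"] n y1 by (simp add: br basis_vec_def)
    have "b * y 2 \<noteq> 0"
    proof
      assume by2: "b * y 2 = 0"
      have "bracket ?A y w = 0"
        using n y1 dy yk by2 by (auto simp: br fun_eq_iff)
      with w show False ..
    qed
    then show ?thesis using cy dy by auto
  qed
qed

text \<open>
  Any two elements have a nontrivial linear combination \<open>y\<close> with \<open>y\<^sub>1 = 0\<close>, and its square is
  \<open>d y\<^sub>2\<^sup>2 e\<^sub>n\<^sub>+\<^sub>1\<close>. If \<open>d \<noteq> 0\<close>, the plane spanned by \<open>e\<^sub>1\<close> and \<open>e\<^sub>2\<close> contains no square-zero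
  element except \<open>0\<close>.
\<close>

lemma planes_meet_null_cone_ext_algebra:
  "planes_meet_null_cone (ext_algebra n a b c d) \<longleftrightarrow> d = 0"
proof
  let ?A = "ext_algebra n a b c d"
  note br = bracket_ext_algebra[OF n]
  have e: "basis_vec 1 \<in> carrier ?A" "basis_vec 2 \<in> carrier ?A"
    using n basis_vec_in_ext_algebra by simp_all
  show "d = 0" if hyp: "planes_meet_null_cone ?A"
  proof (rule ccontr)
    assume d: "d \<noteq> 0"
    let ?z = "\<lambda>s t. smul ?A s (basis_vec 1) + smul ?A t (basis_vec 2)"
    obtain s t where st: "s \<noteq> 0 \<or> t \<noteq> 0" and z: "bracket ?A (?z s t) (?z s t) = 0"
      using hyp e unfolding planes_meet_null_cone_def by blast
    have "s = 0" using fun_cong[OF z, of 3] by (simp add: br basis_vec_def)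
    moreover have "t = 0" using fun_cong[OF z, of "n + 1"] calculation d n by (simp add: br basis_vec_def)
    ultimately show False using st by simp
  qed
  show "planes_meet_null_cone ?A" if d: "d = 0"
    unfolding planes_meet_null_cone_def
  proof (intro ballI)
    fix y z :: "nat \<Rightarrow> complex"
    define s t where "s = (if y 1 = 0 then 1 else z 1)" and "t = (if y 1 = 0 then 0 else - y 1)"
    have st: "s * y 1 + t * z 1 = 0" "s \<noteq> 0 \<or> t \<noteq> 0" by (auto simp: s_def t_def)
    have "bracket ?A x x = 0" if "x 1 = 0" for x
      using that d by (auto simp: br fun_eq_iff)
    then have "bracket ?A (smul ?A s y + smul ?A t z) (smul ?A s y + smul ?A t z) = 0"
      using st(1) by simp
    with st(2) show "\<exists>s t. (s \<noteq> 0 \<or> t \<noteq> 0) \<and> bracket ?A (smul ?A s y + smul ?A t z) (smul ?A s y + smul ?A t z) = 0"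
      by blast
  qed
qed

text \<open>
  If \<open>b = c\<close>, then \<open>e\<^sub>2\<close> commutes with everything. If \<open>b \<noteq> c\<close>, commuting with \<open>e\<^sub>2\<close> and \<open>e\<^sub>1\<close> forces
  the first two coordinates to vanish, and then the square vanishes.
\<close>

lemma has_commuting_non_null_ext_algebra:
  assumes "d \<noteq> 0"
  shows "has_commuting_non_null (ext_algebra n 0 b c d) \<longleftrightarrow> b = c"
proof
  let ?A = "ext_algebra n 0 b c d"
  note br = bracket_ext_algebra[OF n]
  have e: "basis_vec 1 \<in> carrier ?A" "basis_vec 2 \<in> carrier ?A"
    using n basis_vec_in_ext_algebra by simp_all
  show "has_commuting_non_null ?A" if "b = c"
    unfolding has_commuting_non_null_def
  proof (rule bexI[OF _ e(2)], intro conjI ballI)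
    show "bracket ?A (basis_vec 2) (basis_vec 2) \<noteq> 0"
      using n assms by (intro coordinate_nonzero_imp_nonzero[of _ "n + 1"]) (simp add: br basis_vec_def)
  qed (use n that in \<open>auto simp: br basis_vec_def fun_eq_iff\<close>)
  show "b = c" if hyp: "has_commuting_non_null ?A"
  proof (rule ccontr)
    assume bc: "b \<noteq> c"
    obtain y where y: "bracket ?A y y \<noteq> 0"
      and comm: "\<And>w. w \<in> carrier ?A \<Longrightarrow> bracket ?A y w = bracket ?A w y"
      using hyp unfolding has_commuting_non_null_def by blast
    have y1: "y 1 = 0"
      using fun_cong[OF comm[OF e(2)], of "n + 1"] bc n by (simp add: br basis_vec_def)
    have "y 2 = 0"
      using fun_cong[OF comm[OF e(1)], of "n + 1"] bc n y1 by (simp add: br basis_vec_def)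
    with y1 have "bracket ?A y y = 0" by (auto simp: br fun_eq_iff)
    with y show False ..
  qed
qed

end

text \<open>
  The condition \<open>a = 0 \<or> b = 0\<close> holds for all normal forms. It makes the vanishing of \<open>(b, c, d)\<close> an
  invariant, since for \<open>a \<noteq> 0\<close> the constant \<open>b\<close> can be changed at will.
\<close>

lemma ext_algebra_iso_imp:
  assumes n: "n \<ge> 3"
    and iso: "ext_algebra n a b c d \<cong> ext_algebra n a' b' c' d'"
    and ab: "a = 0 \<or> b = 0" "a' = 0 \<or> b' = 0"
  shows "a = 0 \<longleftrightarrow> a' = 0"
    and "b = 0 \<and> c = 0 \<and> d = 0 \<longleftrightarrow> b' = 0 \<and> c' = 0 \<and> d' = 0"
    and "d = 0 \<longleftrightarrow> d' = 0"
    and "c = 0 \<or> d \<noteq> 0 \<longleftrightarrow> c' = 0 \<or> d' \<noteq> 0"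
    and "a = 0 \<Longrightarrow> q \<noteq> 0 \<Longrightarrow> b \<noteq> 0 \<and> c = q * b \<and> d = 0 \<longleftrightarrow> b' \<noteq> 0 \<and> c' = q * b' \<and> d' = 0"
    and "a = 0 \<Longrightarrow> d \<noteq> 0 \<Longrightarrow> b = c \<longleftrightarrow> b' = c'"
proof -
  note AB = iso_invariants[OF iso ext_algebra_closed[OF n]]
  note BA = iso_invariants[OF alg_iso_sym[OF iso ext_algebra_closed[OF n]] ext_algebra_closed[OF n]]
  show a: "a = 0 \<longleftrightarrow> a' = 0"
    using AB(1)[of "n - 1"] BA(1)[of "n - 1"] has_nonzero_power_ext_algebra[OF n] ab by blast
  show "b = 0 \<and> c = 0 \<and> d = 0 \<longleftrightarrow> b' = 0 \<and> c' = 0 \<and> d' = 0"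
    using AB(2) BA(2) has_central_non_product_ext_algebra[OF n] ab by blast
  show d: "d = 0 \<longleftrightarrow> d' = 0"
    using AB(5) BA(5) planes_meet_null_cone_ext_algebra[OF n] by blast
  show "c = 0 \<or> d \<noteq> 0 \<longleftrightarrow> c' = 0 \<or> d' \<noteq> 0"
    using AB(3) BA(3) square_zero_right_annihilates_ext_algebra[OF n] by blast
  show "b \<noteq> 0 \<and> c = q * b \<and> d = 0 \<longleftrightarrow> b' \<noteq> 0 \<and> c' = q * b' \<and> d' = 0" if "a = 0" "q \<noteq> 0"
    using AB(4)[of q] BA(4)[of q] has_proportional_multiplications_ext_algebra[OF n that(2)] a that by blast
  show "b = c \<longleftrightarrow> b' = c'" if "a = 0" "d \<noteq> 0"
    using AB(6) BA(6) has_commuting_non_null_ext_algebra[OF n] a d that by blast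
qed

section \<open>The classification\<close>

lemma structure_constants_ext_labels:
  assumes "l \<in> ext_labels" "structure_constants l = (a, b, c, d)"
  shows "a = 0 \<or> b = 0" and "a = 0 \<or> a = 1" and "d = 0 \<or> d = 1"
    and "if a = 0 then (if d = 0 then b = 1 \<or> b = 0 \<and> c = 1 else b = 1 \<and> (c = 0 \<or> c = 1))
         else b = 0 \<and> (c = 0 \<or> c = 1 \<and> d = 0)"
  using assms by (auto simp: ext_labels_def)

theorem theorem4p3:
  fixes n :: nat
  assumes "n \<ge> 3"
  shows "(\<forall>(V :: 'v::ab_group_add calgebra) (E :: 'e::ab_group_add calgebra) \<iota> \<pi>.
            central_extension 1 V E (F2 n 0 0) \<iota> \<pi> \<longrightarrow>
              E \<cong> direct_sum (F2 n 0 0) abelian1 \<or>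
              (\<exists>l\<in>ext_labels. E \<cong> labelled_algebra (n + 1) l))
       \<and> (\<forall>l\<in>ext_labels. \<not> direct_sum (F2 n 0 0) abelian1 \<cong> labelled_algebra (n + 1) l)
       \<and> (\<forall>l\<in>ext_labels. \<forall>l'\<in>ext_labels.
            l \<noteq> l' \<longrightarrow> \<not> labelled_algebra (n + 1) l \<cong> labelled_algebra (n + 1) l')"
proof (intro conjI allI impI ballI notI)
  note n = assms
  let ?D = "direct_sum (F2 n 0 0) abelian1"
  note D = direct_sum_iso[OF n]
  note lab = labelled_algebra_iso_ext_algebra[OF n]
  {
    fix V :: "'v calgebra" and E :: "'e calgebra" and \<iota> \<pi>
    assume "central_extension 1 V E (F2 n 0 0) \<iota> \<pi>"
    then obtain a b c d where E: "ext_algebra n a b c d \<cong> E"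
      using central_extension_is_ext_algebra n by blast
    then have E': "E \<cong> ext_algebra n a b c d"
      using ext_algebra_closed[OF n] by (rule alg_iso_sym)
    show "E \<cong> ?D \<or> (\<exists>l\<in>ext_labels. E \<cong> labelled_algebra (n + 1) l)"
      using ext_algebra_normal_form[OF n, of a b c d]
    proof
      assume "ext_algebra n a b c d \<cong> ext_algebra n 0 0 0 0"
      from alg_iso_trans[OF alg_iso_trans[OF E' this] D] show ?thesis ..
    next
      assume "\<exists>l\<in>ext_labels. ext_algebra n a b c d \<cong> labelled_algebra (n + 1) l"
      with alg_iso_trans[OF E'] show ?thesis by blast
    qed
  next
    fix l assume l: "l \<in> ext_labels" and iso: "?D \<cong> labelled_algebra (n + 1) l"
    obtain a b c d where s: "structure_constants l = (a, b, c, d)" by (rule prod_cases4)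
    have "ext_algebra n 0 0 0 0 \<cong> ext_algebra n a b c d"
      by (rule alg_iso_trans[OF alg_iso_trans[OF D iso] lab(1)[OF s]])
    note inv = ext_algebra_iso_imp(1,2)[OF n this]
    note l = structure_constants_ext_labels[OF l s]
    have "a = 0" "b = 0 \<and> c = 0 \<and> d = 0" using inv l(1) by auto
    with l(4) show False by simp
  next
    fix l l' assume l: "l \<in> ext_labels" "l' \<in> ext_labels" "l \<noteq> l'"
      and iso: "labelled_algebra (n + 1) l \<cong> labelled_algebra (n + 1) l'"
    obtain a b c d where s: "structure_constants l = (a, b, c, d)" by (rule prod_cases4)
    obtain a' b' c' d' where s': "structure_constants l' = (a', b', c', d')" by (rule prod_cases4)
    have iso': "ext_algebra n a b c d \<cong> ext_algebra n a' b' c' d'"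
      by (rule alg_iso_trans[OF alg_iso_trans[OF lab(2)[OF s] iso] lab(1)[OF s']])
    note N = structure_constants_ext_labels[OF l(1) s] and N' = structure_constants_ext_labels[OF l(2) s']
    note inv = ext_algebra_iso_imp[OF n iso' N(1) N'(1)]
    have a: "a = a'" using inv(1) N(2) N'(2) by auto
    have d: "d = d'" using inv(3) N(3) N'(3) by auto
    have "b = b' \<and> c = c'"
    proof (cases "a = 0")
      case False
      then show ?thesis using inv(2) a d N N' by auto
    next
      case a0: True
      show ?thesis
      proof (cases "d = 0")
        case False
        then show ?thesis using inv(6) a a0 d N N' by auto
      next
        case True
        then have "b = 1 \<or> b = 0 \<and> c = 1" "b' = 1 \<or> b' = 0 \<and> c' = 1"
          using a a0 d N(4) N'(4) by auto
        \<comment> \<open>A nonzero ratio of \<open>c\<close> to \<open>b\<close> is detected from either side, and the remaining pairs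
          \<open>(1, 0)\<close> and \<open>(0, 1)\<close> differ in the vanishing of \<open>c\<close>.\<close>
        then show ?thesis
          using inv(4) inv(5)[OF a0, of c] inv(5)[OF a0, of c'] True d by auto
      qed
    qed
    with a d s s' have "structure_constants l = structure_constants l'" by simp
    with l(3) show False by (cases l; cases l') auto
  }
qed

end
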